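(* Let $(\mathcal C,\otimes,\mathbf I,c)$ be a symmetric preadditive strict monoidal category, $(V,\sigma)$ a pre-braided object in $\mathcal C$, and $(M,\rho,\lambda)$ a bimodule over $(V,\sigma)$. Then the families of morphisms $M\otimes V^{\otimes n}\to M\otimes V^{\otimes(n-1)}$, $n\ge1$, $$({}^{\rho}d)_n:=(\rho\otimes\mathrm{Id}_{V^{\otimes(n-1)}})\circ(\mathrm{Id}_M\otimes\mathrm{csh}_{-\sigma}^{1,n-1}),$$ $$(d^{\lambda})_n:=(-1)^{n-1}\,c_{M,V^{\otimes(n-1)}}^{-1}\circ(\mathrm{Id}_{V^{\otimes(n-1)}}\otimes\lambda)\circ(\mathrm{csh}_{-\sigma}^{n-1,1}\otimes\mathrm{Id}_M)\circ c_{M,V^{\otimes n}}$$ define a bidegree $-1$ tensor bidifferential for $V$ with coefficients in $M$ on the left, i.e. $({}^{\rho}d)_{n-1}({}^{\rho}d)_n=0$, $(d^{\lambda})_{n-1}(d^{\lambda})_n=0$ and $({}^{\rho}d)_{n-1}(d^{\lambda})_n+(d^{\lambda})_{n-1}({}^{\rho}d)_n=0$ for all $n>1$.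
   Context: In a preadditive monoidal category, $\otimes$ is additive in each variable; $c$ is the symmetric braiding of $\mathcal C$, with $c_{X,Y}:X\otimes Y\to Y\otimes X$. For $\varphi:V^{\otimes l}\to V^{\otimes r}$, $\varphi_i=\mathrm{Id}_{V^{\otimes(i-1)}}\otimes\varphi\otimes\mathrm{Id}$. A pre-braided object is an object $V$ with a morphism $\sigma:V\otimes V\to V\otimes V$ (not necessarily invertible, unrelated to $c_{V,V}$) such that $\sigma_1\sigma_2\sigma_1=\sigma_2\sigma_1\sigma_2$ on $V^{\otimes3}$; then $(V,-\sigma)$ is pre-braided as well. For a pre-braiding $\beta$ and $s\in S_n$ with shortest expression $s=\tau_{i_1}\cdots\tau_{i_k}$ in adjacent transpositions $\tau_i=(i\ i{+}1)$, $T_s^{\beta}=\beta_{i_1}\circ\cdots\circ\beta_{i_k}$ on $V^{\otimes n}$. With $Sh_{p,q}=\{s\in S_{p+q}: s(1)<\dots<s(p),\ s(p+1)<\dots<s(p+q)\}$, $\mathrm{csh}_{\beta}^{p,q}=\sum_{s\in Sh_{p,q}}T^{\beta}_{s^{-1}}:V^{\otimes(p+q)}\to V^{\otimes p}\otimes V^{\otimes q}$. A bimodule over $(V,\sigma)$ is an object $M$ with $\rho:M\otimes V\to M$ and $\lambda:V\otimes M\to M$ such that $\rho(\rho\otimes\mathrm{Id}_V)=\rho(\rho\otimes\mathrm{Id}_V)(\mathrm{Id}_M\otimes\sigma)$, $\lambda(\mathrm{Id}_V\otimes\lambda)=\lambda(\mathrm{Id}_V\otimes\lambda)(\sigma\otimes\mathrm{Id}_M)$,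 and $\rho(\lambda\otimes\mathrm{Id}_V)=\lambda(\mathrm{Id}_V\otimes\rho):V\otimes M\otimes V\to M$. *)

theory Defs
  imports "HOL-Algebra.FiniteProduct" "HOL-Combinatorics.Permutations"
begin

section \<open>Symmetric preadditive strict monoidal categories\<close>

record ('o, 'a) moncat =
  Obj :: "'o set"
  Arr :: "'a set"
  Dom :: "'a \<Rightarrow> 'o"
  Cod :: "'a \<Rightarrow> 'o"
  Id :: "'o \<Rightarrow> 'a"
  Comp :: "'a \<Rightarrow> 'a \<Rightarrow> 'a"  (infixr \<open>\<cdot>\<index>\<close> 60)
  Plus :: "'a \<Rightarrow> 'a \<Rightarrow> 'a"
  Zero :: "'o \<Rightarrow> 'o \<Rightarrow> 'a"
  Unit :: "'o"
  TensorO :: "'o \<Rightarrow> 'o \<Rightarrow> 'o"  (infixr \<open>\<otimes>\<^sub>o\<index>\<close> 75)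
  TensorA :: "'a \<Rightarrow> 'a \<Rightarrow> 'a"  (infixr \<open>\<otimes>\<^sub>a\<index>\<close> 75)
  Braid :: "'o \<Rightarrow> 'o \<Rightarrow> 'a"

definition Hom :: "('o, 'a, 'x) moncat_scheme \<Rightarrow> 'o \<Rightarrow> 'o \<Rightarrow> 'a set" where
  "Hom C X Y = {f \<in> Arr C. Dom C f = X \<and> Cod C f = Y}"

text \<open>The (additive) hom-group in the multiplicative notation of \<open>HOL-Algebra\<close>:
  its \<open>finprod\<close> is the sum of morphisms, its \<open>inv\<close> the negative and its integer power
  the integer multiple of a morphism.\<close>

definition hom_group :: "('o, 'a, 'x) moncat_scheme \<Rightarrow> 'o \<Rightarrow> 'o \<Rightarrow> 'a monoid" where
  "hom_group C X Y = \<lparr>carrier = Hom C X Y, monoid.mult = Plus C, one = Zero C X Y\<rparr>"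

locale category =
  fixes C :: "('o, 'a, 'x) moncat_scheme" (structure)
  assumes Dom_Obj: "f \<in> Arr C \<Longrightarrow> Dom C f \<in> Obj C"
    and Cod_Obj: "f \<in> Arr C \<Longrightarrow> Cod C f \<in> Obj C"
    and Id_Hom: "X \<in> Obj C \<Longrightarrow> Id C X \<in> Hom C X X"
    and Comp_Hom: "f \<in> Hom C X Y \<Longrightarrow> g \<in> Hom C Y Z \<Longrightarrow> g \<cdot> f \<in> Hom C X Z"
    and Comp_Id_left: "f \<in> Hom C X Y \<Longrightarrow> Id C Y \<cdot> f = f"
    and Comp_Id_right: "f \<in> Hom C X Y \<Longrightarrow> f \<cdot> Id C X = f"
    and Comp_assoc: "f \<in> Hom C W X \<Longrightarrow> g \<in> Hom C X Y \<Longrightarrow> h \<in> Hom C Y Z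
      \<Longrightarrow> (h \<cdot> g) \<cdot> f = h \<cdot> (g \<cdot> f)"

locale preadditive_category = category +
  assumes hom_comm_group: "X \<in> Obj C \<Longrightarrow> Y \<in> Obj C \<Longrightarrow> comm_group (hom_group C X Y)"
    and Comp_Plus_left: "f \<in> Hom C X Y \<Longrightarrow> g \<in> Hom C Y Z \<Longrightarrow> h \<in> Hom C Y Z
      \<Longrightarrow> Plus C g h \<cdot> f = Plus C (g \<cdot> f) (h \<cdot> f)"
    and Comp_Plus_right: "f \<in> Hom C X Y \<Longrightarrow> g \<in> Hom C X Y \<Longrightarrow> h \<in> Hom C Y Z
      \<Longrightarrow> h \<cdot> Plus C f g = Plus C (h \<cdot> f) (h \<cdot> g)"

locale strict_monoidal_category = category +
  assumes Unit_Obj: "Unit C \<in> Obj C"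
    and TensorO_Obj: "X \<in> Obj C \<Longrightarrow> Y \<in> Obj C \<Longrightarrow> X \<otimes>\<^sub>o Y \<in> Obj C"
    and TensorA_Hom: "f \<in> Hom C X X' \<Longrightarrow> g \<in> Hom C Y Y'
      \<Longrightarrow> f \<otimes>\<^sub>a g \<in> Hom C (X \<otimes>\<^sub>o Y) (X' \<otimes>\<^sub>o Y')"
    and TensorA_Id: "X \<in> Obj C \<Longrightarrow> Y \<in> Obj C \<Longrightarrow> Id C X \<otimes>\<^sub>a Id C Y = Id C (X \<otimes>\<^sub>o Y)"
    and TensorA_Comp: "f \<in> Hom C X X' \<Longrightarrow> f' \<in> Hom C X' X''
      \<Longrightarrow> g \<in> Hom C Y Y' \<Longrightarrow> g' \<in> Hom C Y' Y''
      \<Longrightarrow> (f' \<cdot> f) \<otimes>\<^sub>a (g' \<cdot> g) = (f' \<otimes>\<^sub>a g') \<cdot> (f \<otimes>\<^sub>a g)"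
    and TensorO_assoc: "X \<in> Obj C \<Longrightarrow> Y \<in> Obj C \<Longrightarrow> Z \<in> Obj C
      \<Longrightarrow> (X \<otimes>\<^sub>o Y) \<otimes>\<^sub>o Z = X \<otimes>\<^sub>o (Y \<otimes>\<^sub>o Z)"
    and TensorO_Unit_left: "X \<in> Obj C \<Longrightarrow> Unit C \<otimes>\<^sub>o X = X"
    and TensorO_Unit_right: "X \<in> Obj C \<Longrightarrow> X \<otimes>\<^sub>o Unit C = X"
    and TensorA_assoc: "f \<in> Arr C \<Longrightarrow> g \<in> Arr C \<Longrightarrow> h \<in> Arr C
      \<Longrightarrow> (f \<otimes>\<^sub>a g) \<otimes>\<^sub>a h = f \<otimes>\<^sub>a (g \<otimes>\<^sub>a h)"
    and TensorA_Unit_left: "f \<in> Arr C \<Longrightarrow> Id C (Unit C) \<otimes>\<^sub>a f = f"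
    and TensorA_Unit_right: "f \<in> Arr C \<Longrightarrow> f \<otimes>\<^sub>a Id C (Unit C) = f"

locale symmetric_strict_monoidal_category = strict_monoidal_category +
  assumes Braid_Hom: "X \<in> Obj C \<Longrightarrow> Y \<in> Obj C \<Longrightarrow> Braid C X Y \<in> Hom C (X \<otimes>\<^sub>o Y) (Y \<otimes>\<^sub>o X)"
    and Braid_natural: "f \<in> Hom C X X' \<Longrightarrow> g \<in> Hom C Y Y'
      \<Longrightarrow> Braid C X' Y' \<cdot> (f \<otimes>\<^sub>a g) = (g \<otimes>\<^sub>a f) \<cdot> Braid C X Y"
    and Braid_TensorO_right: "X \<in> Obj C \<Longrightarrow> Y \<in> Obj C \<Longrightarrow> Z \<in> Obj C
      \<Longrightarrow> Braid C X (Y \<otimes>\<^sub>o Z) = (Id C Y \<otimes>\<^sub>a Braid C X Z) \<cdot> (Braid C X Y \<otimes>\<^sub>a Id C Z)"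
    and Braid_TensorO_left: "X \<in> Obj C \<Longrightarrow> Y \<in> Obj C \<Longrightarrow> Z \<in> Obj C
      \<Longrightarrow> Braid C (X \<otimes>\<^sub>o Y) Z = (Braid C X Z \<otimes>\<^sub>a Id C Y) \<cdot> (Id C X \<otimes>\<^sub>a Braid C Y Z)"
    and Braid_symmetric: "X \<in> Obj C \<Longrightarrow> Y \<in> Obj C
      \<Longrightarrow> Braid C Y X \<cdot> Braid C X Y = Id C (X \<otimes>\<^sub>o Y)"

locale symmetric_preadditive_strict_monoidal_category =
  symmetric_strict_monoidal_category + preadditive_category +
  assumes TensorA_Plus_left: "f \<in> Hom C X X' \<Longrightarrow> g \<in> Hom C X X' \<Longrightarrow> h \<in> Hom C Y Y'
      \<Longrightarrow> Plus C f g \<otimes>\<^sub>a h = Plus C (f \<otimes>\<^sub>a h) (g \<otimes>\<^sub>a h)"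
    and TensorA_Plus_right: "f \<in> Hom C X X' \<Longrightarrow> g \<in> Hom C Y Y' \<Longrightarrow> h \<in> Hom C Y Y'
      \<Longrightarrow> f \<otimes>\<^sub>a Plus C g h = Plus C (f \<otimes>\<^sub>a g) (f \<otimes>\<^sub>a h)"

definition inverse_arr :: "('o, 'a, 'x) moncat_scheme \<Rightarrow> 'a \<Rightarrow> 'a" where
  "inverse_arr C f = (THE g. g \<in> Hom C (Cod C f) (Dom C f) \<and>
     g \<cdot>\<^bsub>C\<^esub> f = Id C (Dom C f) \<and> f \<cdot>\<^bsub>C\<^esub> g = Id C (Cod C f))"

definition scale :: "('o, 'a, 'x) moncat_scheme \<Rightarrow> int \<Rightarrow> 'a \<Rightarrow> 'a" where
  "scale C k f = f [^]\<^bsub>hom_group C (Dom C f) (Cod C f)\<^esub> k"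

definition neg :: "('o, 'a, 'x) moncat_scheme \<Rightarrow> 'a \<Rightarrow> 'a" where
  "neg C f = inv\<^bsub>hom_group C (Dom C f) (Cod C f)\<^esub> f"

section \<open>Pre-braided objects and bimodules\<close>

primrec tpow :: "('o, 'a, 'x) moncat_scheme \<Rightarrow> 'o \<Rightarrow> nat \<Rightarrow> 'o" where
  "tpow C V 0 = Unit C"
| "tpow C V (Suc n) = V \<otimes>\<^sub>o\<^bsub>C\<^esub> tpow C V n"

text \<open>\<open>on_strands C V n \<phi> i\<close> is \<open>\<phi>\<^sub>i\<close> on the \<open>n\<close>-th tensor power of \<open>V\<close>, for
  \<open>\<phi> : V \<otimes> V \<rightarrow> V \<otimes> V\<close> and \<open>1 \<le> i < n\<close>.\<close>

definition on_strands :: "('o, 'a, 'x) moncat_scheme \<Rightarrow> 'o \<Rightarrow> nat \<Rightarrow> 'a \<Rightarrow> nat \<Rightarrow> 'a" where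
  "on_strands C V n \<phi> i =
     Id C (tpow C V (i - 1)) \<otimes>\<^sub>a\<^bsub>C\<^esub> \<phi> \<otimes>\<^sub>a\<^bsub>C\<^esub> Id C (tpow C V (n - (i + 1)))"

definition pre_braided_object :: "('o, 'a, 'x) moncat_scheme \<Rightarrow> 'o \<Rightarrow> 'a \<Rightarrow> bool" where
  "pre_braided_object C V \<sigma> \<longleftrightarrow>
     V \<in> Obj C \<and> \<sigma> \<in> Hom C (V \<otimes>\<^sub>o\<^bsub>C\<^esub> V) (V \<otimes>\<^sub>o\<^bsub>C\<^esub> V) \<and>
     on_strands C V 3 \<sigma> 1 \<cdot>\<^bsub>C\<^esub> on_strands C V 3 \<sigma> 2 \<cdot>\<^bsub>C\<^esub> on_strands C V 3 \<sigma> 1 =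
     on_strands C V 3 \<sigma> 2 \<cdot>\<^bsub>C\<^esub> on_strands C V 3 \<sigma> 1 \<cdot>\<^bsub>C\<^esub> on_strands C V 3 \<sigma> 2"

definition bimodule ::
    "('o, 'a, 'x) moncat_scheme \<Rightarrow> 'o \<Rightarrow> 'a \<Rightarrow> 'o \<Rightarrow> 'a \<Rightarrow> 'a \<Rightarrow> bool" where
  "bimodule C V \<sigma> M \<rho> \<mu> \<longleftrightarrow>
     M \<in> Obj C \<and> \<rho> \<in> Hom C (M \<otimes>\<^sub>o\<^bsub>C\<^esub> V) M \<and> \<mu> \<in> Hom C (V \<otimes>\<^sub>o\<^bsub>C\<^esub> M) M \<and>
     \<rho> \<cdot>\<^bsub>C\<^esub> (\<rho> \<otimes>\<^sub>a\<^bsub>C\<^esub> Id C V) = \<rho> \<cdot>\<^bsub>C\<^esub> (\<rho> \<otimes>\<^sub>a\<^bsub>C\<^esub> Id C V) \<cdot>\<^bsub>C\<^esub> (Id C M \<otimes>\<^sub>a\<^bsub>C\<^esub> \<sigma>) \<and>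
     \<mu> \<cdot>\<^bsub>C\<^esub> (Id C V \<otimes>\<^sub>a\<^bsub>C\<^esub> \<mu>) = \<mu> \<cdot>\<^bsub>C\<^esub> (Id C V \<otimes>\<^sub>a\<^bsub>C\<^esub> \<mu>) \<cdot>\<^bsub>C\<^esub> (\<sigma> \<otimes>\<^sub>a\<^bsub>C\<^esub> Id C M) \<and>
     \<rho> \<cdot>\<^bsub>C\<^esub> (\<mu> \<otimes>\<^sub>a\<^bsub>C\<^esub> Id C V) = \<mu> \<cdot>\<^bsub>C\<^esub> (Id C V \<otimes>\<^sub>a\<^bsub>C\<^esub> \<rho>)"

section \<open>Quantum co-shuffles\<close>

text \<open>A word \<open>[i\<^sub>1, \<dots>, i\<^sub>k]\<close> stands for the permutation
  \<open>\<tau>\<^bsub>i\<^sub>1\<^esub> \<circ> \<dots> \<circ> \<tau>\<^bsub>i\<^sub>k\<^esub>\<close> with \<open>\<tau>\<^sub>i = (i i+1)\<close>.\<close>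

definition word_perm :: "nat list \<Rightarrow> nat \<Rightarrow> nat" where
  "word_perm w = foldr (\<lambda>i s. transpose i (i + 1) \<circ> s) w id"

text \<open>A shortest expression of \<open>s\<close>, a permutation of \<open>{1..n}\<close>. For a pre-braiding \<open>\<beta>\<close>
  the morphism \<open>T C V \<beta> n s\<close> does not depend on which shortest expression is selected,
  since any two of them are related by braid moves.\<close>

definition shortest_word :: "nat \<Rightarrow> (nat \<Rightarrow> nat) \<Rightarrow> nat list" where
  "shortest_word n s = (ARG_MIN length w. set w \<subseteq> {1..<n} \<and> word_perm w = s)"

definition T :: "('o, 'a, 'x) moncat_scheme \<Rightarrow> 'o \<Rightarrow> 'a \<Rightarrow> nat \<Rightarrow> (nat \<Rightarrow> nat) \<Rightarrow> 'a" where
  "T C V \<beta> n s =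
     foldr (\<lambda>i f. on_strands C V n \<beta> i \<cdot>\<^bsub>C\<^esub> f) (shortest_word n s) (Id C (tpow C V n))"

definition Sh :: "nat \<Rightarrow> nat \<Rightarrow> (nat \<Rightarrow> nat) set" where
  "Sh p q = {s. s permutes {1..p + q} \<and>
     strict_mono_on {1..p} s \<and> strict_mono_on {p + 1..p + q} s}"

definition csh :: "('o, 'a, 'x) moncat_scheme \<Rightarrow> 'o \<Rightarrow> 'a \<Rightarrow> nat \<Rightarrow> nat \<Rightarrow> 'a" where
  "csh C V \<beta> p q =
     finprod (hom_group C (tpow C V (p + q)) (tpow C V p \<otimes>\<^sub>o\<^bsub>C\<^esub> tpow C V q))
       (\<lambda>s. T C V \<beta> (p + q) (Hilbert_Choice.inv s)) (Sh p q)"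

section \<open>Tensor bidifferentials\<close>

definition rho_d :: "('o, 'a, 'x) moncat_scheme \<Rightarrow> 'o \<Rightarrow> 'a \<Rightarrow> 'o \<Rightarrow> 'a \<Rightarrow> nat \<Rightarrow> 'a" where
  "rho_d C V \<sigma> M \<rho> n =
     (\<rho> \<otimes>\<^sub>a\<^bsub>C\<^esub> Id C (tpow C V (n - 1))) \<cdot>\<^bsub>C\<^esub> (Id C M \<otimes>\<^sub>a\<^bsub>C\<^esub> csh C V (neg C \<sigma>) 1 (n - 1))"

definition d_lambda :: "('o, 'a, 'x) moncat_scheme \<Rightarrow> 'o \<Rightarrow> 'a \<Rightarrow> 'o \<Rightarrow> 'a \<Rightarrow> nat \<Rightarrow> 'a" where
  "d_lambda C V \<sigma> M \<mu> n =
     scale C ((-1) ^ (n - 1))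
       (inverse_arr C (Braid C M (tpow C V (n - 1))) \<cdot>\<^bsub>C\<^esub>
        (Id C (tpow C V (n - 1)) \<otimes>\<^sub>a\<^bsub>C\<^esub> \<mu>) \<cdot>\<^bsub>C\<^esub>
        (csh C V (neg C \<sigma>) (n - 1) 1 \<otimes>\<^sub>a\<^bsub>C\<^esub> Id C M) \<cdot>\<^bsub>C\<^esub>
        Braid C M (tpow C V n))"

text \<open>Tensor bidifferentials of bidegree \<open>-1\<close> for \<open>V\<close> with coefficients in \<open>M\<close> on the left.
  The members of the families at index \<open>0\<close> are irrelevant.\<close>

definition tensor_bidifferential ::
    "('o, 'a, 'x) moncat_scheme \<Rightarrow> 'o \<Rightarrow> 'o \<Rightarrow> (nat \<Rightarrow> 'a) \<Rightarrow> (nat \<Rightarrow> 'a) \<Rightarrow> bool" where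
  "tensor_bidifferential C V M d d' \<longleftrightarrow>
     (\<forall>n\<ge>1. d n \<in> Hom C (M \<otimes>\<^sub>o\<^bsub>C\<^esub> tpow C V n) (M \<otimes>\<^sub>o\<^bsub>C\<^esub> tpow C V (n - 1)) \<and>
             d' n \<in> Hom C (M \<otimes>\<^sub>o\<^bsub>C\<^esub> tpow C V n) (M \<otimes>\<^sub>o\<^bsub>C\<^esub> tpow C V (n - 1))) \<and>
     (\<forall>n>1. d (n - 1) \<cdot>\<^bsub>C\<^esub> d n = Zero C (M \<otimes>\<^sub>o\<^bsub>C\<^esub> tpow C V n) (M \<otimes>\<^sub>o\<^bsub>C\<^esub> tpow C V (n - 2)) \<and>
            d' (n - 1) \<cdot>\<^bsub>C\<^esub> d' n = Zero C (M \<otimes>\<^sub>o\<^bsub>C\<^esub> tpow C V n) (M \<otimes>\<^sub>o\<^bsub>C\<^esub> tpow C V (n - 2)) \<and>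
            Plus C (d (n - 1) \<cdot>\<^bsub>C\<^esub> d' n) (d' (n - 1) \<cdot>\<^bsub>C\<^esub> d n) =
              Zero C (M \<otimes>\<^sub>o\<^bsub>C\<^esub> tpow C V n) (M \<otimes>\<^sub>o\<^bsub>C\<^esub> tpow C V (n - 2)))"

end

theory Submission
  imports Defs "HOL-Algebra.Ring"
begin

text \<open>
  Both families are built in the same way: a co-shuffle singles out one strand, and this strand acts
  on \<open>M\<close>. For \<open>\<^sup>\<rho>d\<close> it is brought to the front and acts by \<open>\<rho>\<close>. For
  \<open>d\<^sup>\<lambda>\<close> it is brought to the end, moved to \<open>M\<close> by the symmetry and acts by
  \<open>\<nu> = \<mu> \<circ> c\<close>, where \<open>\<mu>\<close> is the left action (lemma \<open>last_action_eq\<close>).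
  Since an operation on the remaining strands slides past such an action, a composite of two
  differentials is a pair of actions after a pair of co-shuffles. It remains to understand pairs of
  actions and pairs of co-shuffles separately.

  Co-shuffles of one strand are sums of words in the crossings
  \<open>b\<^sub>0, b\<^sub>1, \<dots>\<close> of neighbouring strands: \<open>1 + b\<^sub>0 + b\<^sub>0 b\<^sub>1 + \<dots>\<close>
  for the first strand and the same with the crossings in reversed order for the last one. For
  this it is enough that the permutations in question have a unique shortest word, which one sees by
  following a single point. Two facts about these sums hold in every ring whose elements
  \<open>b\<^sub>i\<close> satisfy the braid relations:

  \<^item> the sum without its first crossing, times the full sum, is a right multiple of
    \<open>1 + b\<^sub>0\<close> (lemma \<open>prefix_sum_factor\<close>);
  \<^item> splitting off a strand on the left and one on the right can be done in either order
    (lemma \<open>prefix_sum_coassoc\<close>).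

  The crossings here come from \<open>-\<sigma>\<close>. Two actions from the same side vanish after
  \<open>1 - \<sigma>\<close> by the module axioms, so the first fact yields that both families square to zero.
  The actions of the first and of the last strand commute because \<open>M\<close> is a bimodule (lemma
  \<open>first_last_action_commute\<close>), so with the second fact the two families commute without
  the sign in \<open>d\<^sup>\<lambda>\<close>. This sign alternates with the degree and turns commutation into
  anticommutation.
\<close>

section \<open>Sums over initial words in a braid family\<close>

primrec prefix_prod :: "('a, 'm) ring_scheme \<Rightarrow> (nat \<Rightarrow> 'a) \<Rightarrow> nat \<Rightarrow> 'a" where
  "prefix_prod R b 0 = \<one>\<^bsub>R\<^esub>"
| "prefix_prod R b (Suc k) = prefix_prod R b k \<otimes>\<^bsub>R\<^esub> b k"

text \<open>With \<open>b i\<close> the crossing of the strands \<open>i\<close> and \<open>i + 1\<close>, counted from \<open>0\<close>, the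
  prefix product of length \<open>j\<close> carries the strand \<open>j\<close> to the front. The sum of all of them is a quantum co-shuffle
  that splits off one strand on the left. The reversed sequence of generators gives the co-shuffle
  that splits off one strand on the right, so that one formalism serves both sides.\<close>

primrec prefix_sum :: "('a, 'm) ring_scheme \<Rightarrow> (nat \<Rightarrow> 'a) \<Rightarrow> nat \<Rightarrow> 'a" where
  "prefix_sum R b 0 = \<one>\<^bsub>R\<^esub>"
| "prefix_sum R b (Suc k) = prefix_sum R b k \<oplus>\<^bsub>R\<^esub> prefix_prod R b (Suc k)"

text \<open>The elements \<open>b 0, \<dots>, b (n - 1)\<close> satisfy the relations of the monoid of
  positive braids on \<open>n + 1\<close> strands.\<close>

definition braid_family :: "('a, 'm) ring_scheme \<Rightarrow> (nat \<Rightarrow> 'a) \<Rightarrow> nat \<Rightarrow> bool" where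
  "braid_family R b n \<longleftrightarrow>
     (\<forall>i<n. b i \<in> carrier R) \<and>
     (\<forall>i j. i + 1 < j \<and> j < n \<longrightarrow> b i \<otimes>\<^bsub>R\<^esub> b j = b j \<otimes>\<^bsub>R\<^esub> b i) \<and>
     (\<forall>i. i + 1 < n \<longrightarrow> b i \<otimes>\<^bsub>R\<^esub> (b (i + 1) \<otimes>\<^bsub>R\<^esub> b i) = b (i + 1) \<otimes>\<^bsub>R\<^esub> (b i \<otimes>\<^bsub>R\<^esub> b (i + 1)))"

lemma braid_familyD:
  assumes "braid_family R b n"
  shows "i < n \<Longrightarrow> b i \<in> carrier R"
    and "i + 1 < j \<Longrightarrow> j < n \<Longrightarrow> b i \<otimes>\<^bsub>R\<^esub> b j = b j \<otimes>\<^bsub>R\<^esub> b i"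
    and "i + 1 < n \<Longrightarrow>
      b i \<otimes>\<^bsub>R\<^esub> (b (i + 1) \<otimes>\<^bsub>R\<^esub> b i) = b (i + 1) \<otimes>\<^bsub>R\<^esub> (b i \<otimes>\<^bsub>R\<^esub> b (i + 1))"
  using assms unfolding braid_family_def by blast+

lemma braid_family_tail: "braid_family R b (Suc n) \<Longrightarrow> braid_family R (\<lambda>i. b (Suc i)) n"
  unfolding braid_family_def by force

lemma braid_family_mono: "braid_family R b n \<Longrightarrow> m \<le> n \<Longrightarrow> braid_family R b m"
  unfolding braid_family_def by (meson less_le_trans)

text \<open>The braid relations are invariant under the reflection of the strands. This transports every
  result about splitting off the first strand to the last one.\<close>

lemma braid_family_rev:
  assumes "braid_family R b (Suc k)"
  shows "braid_family R (\<lambda>i. b (k - i)) (Suc k)"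
  unfolding braid_family_def
proof (intro conjI allI impI)
  fix i assume "i < Suc k"
  then show "b (k - i) \<in> carrier R"
    using braid_familyD(1)[OF assms] by simp
next
  fix i j assume "i + 1 < j \<and> j < Suc k"
  then show "b (k - i) \<otimes>\<^bsub>R\<^esub> b (k - j) = b (k - j) \<otimes>\<^bsub>R\<^esub> b (k - i)"
    using braid_familyD(2)[OF assms, of "k - j" "k - i"] by force
next
  fix i assume "i + 1 < Suc k"
  then obtain j where j: "k = j + i + 1" by (metis add.commute less_Suc_eq_le add.assoc add.left_commute le_Suc_ex)
  then show "b (k - i) \<otimes>\<^bsub>R\<^esub> (b (k - (i + 1)) \<otimes>\<^bsub>R\<^esub> b (k - i)) =
      b (k - (i + 1)) \<otimes>\<^bsub>R\<^esub> (b (k - i) \<otimes>\<^bsub>R\<^esub> b (k - (i + 1)))"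
    using braid_familyD(3)[OF assms, of j] by simp
qed

context ring
begin

lemma prefix_prod_closed: "(\<And>i. i < k \<Longrightarrow> b i \<in> carrier R) \<Longrightarrow> prefix_prod R b k \<in> carrier R"
  by (induction k) auto

lemma prefix_sum_closed: "(\<And>i. i < k \<Longrightarrow> b i \<in> carrier R) \<Longrightarrow> prefix_sum R b k \<in> carrier R"
  by (induction k) (auto simp: prefix_prod_closed)

lemma prefix_prod_Suc_left:
  assumes "\<And>i. i < Suc k \<Longrightarrow> b i \<in> carrier R"
  shows "prefix_prod R b (Suc k) = b 0 \<otimes> prefix_prod R (\<lambda>i. b (Suc i)) k"
  using assms
proof (induction k)
  case (Suc k)
  then have "prefix_prod R (\<lambda>i. b (Suc i)) k \<in> carrier R" by (intro prefix_prod_closed) auto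
  with Suc show ?case by (simp add: m_assoc)
qed simp

lemma prefix_sum_Suc_left:
  assumes "\<And>i. i < Suc k \<Longrightarrow> b i \<in> carrier R"
  shows "prefix_sum R b (Suc k) = \<one> \<oplus> b 0 \<otimes> prefix_sum R (\<lambda>i. b (Suc i)) k"
  using assms
proof (induction k)
  case (Suc k)
  have c: "prefix_sum R (\<lambda>i. b (Suc i)) k \<in> carrier R" "prefix_prod R (\<lambda>i. b (Suc i)) (Suc k) \<in> carrier R"
    using Suc.prems by (intro prefix_sum_closed prefix_prod_closed; simp)+
  have "prefix_sum R b (Suc (Suc k)) =
      (\<one> \<oplus> b 0 \<otimes> prefix_sum R (\<lambda>i. b (Suc i)) k) \<oplus> b 0 \<otimes> prefix_prod R (\<lambda>i. b (Suc i)) (Suc k)"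
    using Suc prefix_prod_Suc_left[of "Suc k" b] by simp
  also have "\<dots> = \<one> \<oplus> b 0 \<otimes> prefix_sum R (\<lambda>i. b (Suc i)) (Suc k)"
    using c Suc.prems[of 0] by (simp add: r_distr a_assoc del: prefix_prod.simps)
  finally show ?case .
qed simp

lemma prefix_prod_intertwine:
  assumes "x \<in> carrier R" "\<And>i. i < k \<Longrightarrow> b i \<in> carrier R" "\<And>i. i < k \<Longrightarrow> c i \<in> carrier R"
    and "\<And>i. i < k \<Longrightarrow> x \<otimes> b i = c i \<otimes> x"
  shows "x \<otimes> prefix_prod R b k = prefix_prod R c k \<otimes> x"
  using assms
proof (induction k)
  case (Suc k)
  have c: "prefix_prod R b k \<in> carrier R" "prefix_prod R c k \<in> carrier R"
    using Suc.prems by (auto intro: prefix_prod_closed)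
  have "x \<otimes> prefix_prod R b (Suc k) = (x \<otimes> prefix_prod R b k) \<otimes> b k"
    using Suc.prems c by (simp add: m_assoc)
  also have "\<dots> = prefix_prod R c k \<otimes> (x \<otimes> b k)"
    using Suc c by (simp add: m_assoc)
  also have "\<dots> = prefix_prod R c (Suc k) \<otimes> x"
    using Suc.prems(1-3) Suc.prems(4)[of k] c by (simp add: m_assoc)
  finally show ?case .
qed simp

text \<open>Taken with \<open>c = b\<close> this moves a crossing past a co-shuffle on distant strands; taken with
  \<open>c\<close> a shift of \<open>b\<close> it describes a strand that crosses all the strands of the co-shuffle.\<close>

lemma prefix_sum_intertwine:
  assumes "x \<in> carrier R" "\<And>i. i < k \<Longrightarrow> b i \<in> carrier R" "\<And>i. i < k \<Longrightarrow> c i \<in> carrier R"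
    and "\<And>i. i < k \<Longrightarrow> x \<otimes> b i = c i \<otimes> x"
  shows "x \<otimes> prefix_sum R b k = prefix_sum R c k \<otimes> x"
  using assms
proof (induction k)
  case (Suc k)
  have c: "prefix_sum R b k \<in> carrier R" "prefix_sum R c k \<in> carrier R"
    "prefix_prod R b (Suc k) \<in> carrier R" "prefix_prod R c (Suc k) \<in> carrier R"
    using Suc.prems by (intro prefix_sum_closed prefix_prod_closed; simp)+
  then show ?case
    using Suc prefix_prod_intertwine[of x "Suc k" b c]
    by (simp add: r_distr l_distr del: prefix_prod.simps)
qed simp

text \<open>A strand that passes over the whole bunch carries a crossing from its one side to the other
  (the third Reidemeister move). When the strand starts one place further to the right, its new
  crossing is distant from all crossings treated so far, and for the one new crossing that it
  has to pass the braid relation applies.\<close>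

lemma prefix_prod_shift:
  assumes b: "braid_family R b (Suc k)" and i: "i < k"
  shows "prefix_prod R b (Suc k) \<otimes> b i = b (Suc i) \<otimes> prefix_prod R b (Suc k)"
  using assms
proof (induction k)
  case (Suc k)
  note bc = braid_familyD(1)[OF Suc.prems(1)]
  have b': "braid_family R b (Suc k)"
    using Suc.prems(1) by (rule braid_family_mono) simp
  have c: "prefix_prod R b (Suc k) \<in> carrier R" "prefix_prod R b k \<in> carrier R"
    using bc by (intro prefix_prod_closed; simp)+
  show ?case
  proof (cases "i < k")
    case True
    have "prefix_prod R b (Suc (Suc k)) \<otimes> b i = prefix_prod R b (Suc k) \<otimes> (b (Suc k) \<otimes> b i)"
      using Suc.prems(2) c bc by (subst prefix_prod.simps) (simp add: m_assoc del: prefix_prod.simps)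
    also have "b (Suc k) \<otimes> b i = b i \<otimes> b (Suc k)"
      using braid_familyD(2)[OF Suc.prems(1), of i "Suc k"] True by simp
    also have "prefix_prod R b (Suc k) \<otimes> (b i \<otimes> b (Suc k)) =
        (prefix_prod R b (Suc k) \<otimes> b i) \<otimes> b (Suc k)"
      using True c bc by (simp add: m_assoc del: prefix_prod.simps)
    also have "\<dots> = b (Suc i) \<otimes> prefix_prod R b (Suc (Suc k))"
      unfolding Suc.IH[OF b' True] prefix_prod.simps(2)[of R b "Suc k"]
      using True c bc by (simp add: m_assoc del: prefix_prod.simps)
    finally show ?thesis .
  next
    case False
    with Suc.prems(2) have i: "i = k" by simp
    have comm: "b (Suc k) \<otimes> prefix_prod R b k = prefix_prod R b k \<otimes> b (Suc k)"
      using bc braid_familyD(2)[OF Suc.prems(1), of _ "Suc k"]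
      by (intro prefix_prod_intertwine) auto
    have "prefix_prod R b (Suc (Suc k)) \<otimes> b k =
        prefix_prod R b k \<otimes> (b k \<otimes> (b (Suc k) \<otimes> b k))"
      using c bc by (simp add: m_assoc)
    also have "b k \<otimes> (b (Suc k) \<otimes> b k) = b (Suc k) \<otimes> (b k \<otimes> b (Suc k))"
      using braid_familyD(3)[OF Suc.prems(1), of k] by simp
    also have "prefix_prod R b k \<otimes> (b (Suc k) \<otimes> (b k \<otimes> b (Suc k))) =
        (b (Suc k) \<otimes> prefix_prod R b k) \<otimes> (b k \<otimes> b (Suc k))"
      unfolding comm using c bc by (simp add: m_assoc)
    also have "\<dots> = b (Suc k) \<otimes> prefix_prod R b (Suc (Suc k))"
      using c bc by (simp add: m_assoc)
    finally show ?thesis using i by simp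
  qed
qed simp

text \<open>This is why a co-shuffle differential squares to zero: splitting off two strands one after the
  other produces each pair in both orders, and the two orders differ by the crossing \<open>b 0\<close>.
  With \<open>L = 1 + b 0 L'\<close> and \<open>L' = 1 + b 1 L''\<close>, where \<open>L''\<close> commutes with \<open>b 0\<close>,
  one gets \<open>L' L = (1 + b 0) L' + b 1 b 0 L'' L'\<close>. By induction
  \<open>L'' L' = (1 + b 1) y\<close>, and the braid relation gives
  \<open>b 1 b 0 (1 + b 1) = (1 + b 0) b 1 b 0\<close>.\<close>

lemma prefix_sum_factor:
  assumes "braid_family R b (Suc k)"
  shows "\<exists>y \<in> carrier R.
    prefix_sum R (\<lambda>i. b (Suc i)) k \<otimes> prefix_sum R b (Suc k) = (\<one> \<oplus> b 0) \<otimes> y"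
  using assms
proof (induction k arbitrary: b)
  case 0
  then show ?case using braid_familyD(1)[OF 0, of 0] by (intro bexI[of _ \<one>]) auto
next
  case (Suc k)
  note bc = braid_familyD(1)[OF Suc.prems]
  define b' where "b' = (\<lambda>i. b (Suc i))"
  have b': "braid_family R b' (Suc k)"
    unfolding b'_def using Suc.prems by (rule braid_family_tail)
  define L where "L = prefix_sum R b (Suc (Suc k))"
  define L' where "L' = prefix_sum R b' (Suc k)"
  define L'' where "L'' = prefix_sum R (\<lambda>i. b' (Suc i)) k"
  have c: "L' \<in> carrier R" "L'' \<in> carrier R" "b 0 \<in> carrier R" "b' 0 \<in> carrier R"
    using bc unfolding L'_def L''_def b'_def by (auto intro!: prefix_sum_closed simp del: prefix_sum.simps)
  obtain y where y: "y \<in> carrier R" "L'' \<otimes> L' = (\<one> \<oplus> b' 0) \<otimes> y"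
    using Suc.IH[OF b'] unfolding L'_def L''_def by blast
  have L: "L = \<one> \<oplus> b 0 \<otimes> L'"
    unfolding L_def L'_def b'_def using bc by (intro prefix_sum_Suc_left) auto
  have L': "L' = \<one> \<oplus> b' 0 \<otimes> L''"
    unfolding L'_def L''_def using bc by (intro prefix_sum_Suc_left) (auto simp: b'_def)
  have comm: "b 0 \<otimes> L'' = L'' \<otimes> b 0"
    unfolding L''_def using bc braid_familyD(2)[OF Suc.prems, of 0]
    by (intro prefix_sum_intertwine) (auto simp: b'_def)
  have br: "b 0 \<otimes> (b' 0 \<otimes> b 0) = b' 0 \<otimes> (b 0 \<otimes> b' 0)"
    using braid_familyD(3)[OF Suc.prems, of 0] by (simp add: b'_def)
  have "L' \<otimes> L = L' \<oplus> L' \<otimes> (b 0 \<otimes> L')"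
    unfolding L using c by (simp add: r_distr)
  also have "L' \<otimes> (b 0 \<otimes> L') = b 0 \<otimes> L' \<oplus> b' 0 \<otimes> ((L'' \<otimes> b 0) \<otimes> L')"
    by (subst (1) L') (use c in \<open>simp add: l_distr m_assoc\<close>)
  also have "(L'' \<otimes> b 0) \<otimes> L' = b 0 \<otimes> (L'' \<otimes> L')"
    unfolding comm[symmetric] using c by (simp add: m_assoc)
  also have "b' 0 \<otimes> (b 0 \<otimes> (L'' \<otimes> L')) = b' 0 \<otimes> (b 0 \<otimes> y) \<oplus> (b' 0 \<otimes> (b 0 \<otimes> b' 0)) \<otimes> y"
    unfolding y using c y(1) by (simp add: l_distr r_distr m_assoc)
  also have "(b' 0 \<otimes> (b 0 \<otimes> b' 0)) \<otimes> y = b 0 \<otimes> (b' 0 \<otimes> (b 0 \<otimes> y))"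
    unfolding br[symmetric] using c y(1) by (simp add: m_assoc)
  finally have "L' \<otimes> L = (\<one> \<oplus> b 0) \<otimes> (L' \<oplus> b' 0 \<otimes> (b 0 \<otimes> y))"
    using c y(1) by (simp add: l_distr r_distr a_ac)
  then show ?case
    unfolding L_def L'_def b'_def[symmetric]
    using c y(1) L'_def by (intro bexI[of _ "L' \<oplus> b' 0 \<otimes> (b 0 \<otimes> y)"]) auto
qed

text \<open>Splitting off the last strand and then the first one agrees with doing it in the opposite order:
  coassociativity of the co-shuffle. In the induction, the terms of the left co-shuffle which
  do not reach the new last strand commute with its crossing, and the longest term \<open>P'\<close>
  shifts the right co-shuffle by one strand.\<close>

lemma prefix_sum_coassoc:
  assumes "braid_family R b (Suc k)"
  shows "prefix_sum R b k \<otimes> prefix_sum R (\<lambda>i. b (k - i)) (Suc k) =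
    prefix_sum R (\<lambda>i. b (k - i)) k \<otimes> prefix_sum R b (Suc k)"
  using assms
proof (induction k)
  case 0
  then show ?case using braid_familyD(1)[OF 0, of 0] by simp
next
  case (Suc k)
  note bc = braid_familyD(1)[OF Suc.prems]
  have b': "braid_family R b (Suc k)"
    using Suc.prems by (rule braid_family_mono) simp
  define l where "l = prefix_sum R b k"
  define l' where "l' = prefix_sum R b (Suc k)"
  define P where "P = prefix_prod R b (Suc k)"
  define P' where "P' = prefix_prod R b (Suc (Suc k))"
  define r where "r = prefix_sum R (\<lambda>i. b (k - i)) k"
  define r' where "r' = prefix_sum R (\<lambda>i. b (k - i)) (Suc k)"
  define q where "q = prefix_sum R (\<lambda>i. b (Suc k - i)) (Suc k)"
  define q' where "q' = prefix_sum R (\<lambda>i. b (Suc k - i)) (Suc (Suc k))"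
  let ?x = "b (Suc k)"
  have c: "l \<in> carrier R" "l' \<in> carrier R" "P \<in> carrier R" "P' \<in> carrier R" "r \<in> carrier R"
    "r' \<in> carrier R" "q \<in> carrier R" "?x \<in> carrier R"
    using bc unfolding l_def l'_def P_def P'_def r_def r'_def q_def
    by (auto intro!: prefix_sum_closed prefix_prod_closed simp del: prefix_sum.simps prefix_prod.simps)
  have q: "q = \<one> \<oplus> ?x \<otimes> r"
    unfolding q_def r_def using prefix_sum_Suc_left[of k "\<lambda>i. b (Suc k - i)"] bc by simp
  have q': "q' = \<one> \<oplus> ?x \<otimes> r'"
    unfolding q'_def r'_def using prefix_sum_Suc_left[of "Suc k" "\<lambda>i. b (Suc k - i)"] bc by simp
  have IH: "l \<otimes> r' = r \<otimes> l'"
    using Suc.IH[OF b'] unfolding l_def r'_def r_def l'_def .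
  have l': "l' = l \<oplus> P" unfolding l'_def l_def P_def by simp
  have P': "P' = P \<otimes> ?x" unfolding P'_def P_def by simp
  have comm: "?x \<otimes> l = l \<otimes> ?x"
    unfolding l_def using bc braid_familyD(2)[OF Suc.prems, of _ "Suc k"]
    by (intro prefix_sum_intertwine) auto
  have shift: "P' \<otimes> r' = q \<otimes> P'"
    unfolding r'_def q_def
  proof (rule prefix_sum_intertwine)
    fix i assume "i < Suc k"
    then show "P' \<otimes> b (k - i) = b (Suc k - i) \<otimes> P'"
      using prefix_prod_shift[OF Suc.prems, of "k - i"] unfolding P'_def by (simp add: Suc_diff_le)
  qed (use c bc in auto)
  have "l' \<otimes> q' = l' \<oplus> ((l \<otimes> ?x) \<otimes> r' \<oplus> (P \<otimes> ?x) \<otimes> r')"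
    unfolding q' using c l' by (simp add: r_distr l_distr m_assoc)
  also have "(l \<otimes> ?x) \<otimes> r' = (?x \<otimes> r) \<otimes> l'"
    unfolding comm[symmetric] using c by (simp add: m_assoc IH)
  also have "(P \<otimes> ?x) \<otimes> r' = q \<otimes> P'"
    using shift unfolding P' .
  also have "l' \<oplus> ((?x \<otimes> r) \<otimes> l' \<oplus> q \<otimes> P') = q \<otimes> (l' \<oplus> P')"
    using c by (simp add: r_distr) (simp add: q l_distr a_assoc)
  finally show ?case
    unfolding l'_def q'_def q_def P'_def by simp
qed

end

lemma ring_hom_prefix_sum:
  assumes "ring R" "ring S" "h \<in> ring_hom R S" "\<And>i. i < k \<Longrightarrow> b i \<in> carrier R"
  shows "h (prefix_sum R b k) = prefix_sum S (\<lambda>i. h (b i)) k"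
proof -
  interpret R: ring R by fact
  interpret S: ring S by fact
  have prod: "h (prefix_prod R b k) = prefix_prod S (\<lambda>i. h (b i)) k" if "\<And>i. i < k \<Longrightarrow> b i \<in> carrier R" for k
    using that
    by (induction k) (simp_all add: ring_hom_one[OF assms(3)] ring_hom_mult[OF assms(3)] R.prefix_prod_closed)
  show ?thesis
    using assms(4)
  proof (induction k)
    case (Suc k)
    have "prefix_sum R b k \<in> carrier R" "prefix_prod R b (Suc k) \<in> carrier R"
      using Suc.prems by (intro R.prefix_sum_closed R.prefix_prod_closed; simp)+
    then show ?case
      using Suc prod[of "Suc k"] by (simp add: ring_hom_add[OF assms(3)] del: prefix_prod.simps)
  qed (simp add: ring_hom_one[OF assms(3)])
qed

lemma prefix_sum_cong: "(\<And>i. i < k \<Longrightarrow> b i = c i) \<Longrightarrow> prefix_sum R b k = prefix_sum R c k"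
proof -
  assume eq: "\<And>i. i < k \<Longrightarrow> b i = c i"
  have "prefix_prod R b j = prefix_prod R c j" if "j \<le> k" for j
    using that eq by (induction j) auto
  then have "prefix_sum R b j = prefix_sum R c j" if "j \<le> k" for j
    using that by (induction j) (auto simp del: prefix_prod.simps)
  then show ?thesis by simp
qed

section \<open>Shortest words of shuffles that move one element\<close>

lemma word_perm_snoc: "word_perm (w @ [i]) = word_perm w \<circ> transpose i (Suc i)"
proof -
  have "foldr (\<lambda>i s. transpose i (i + 1) \<circ> s) w t = word_perm w \<circ> t" for t
    unfolding word_perm_def by (induction w) (auto simp: o_assoc)
  then show ?thesis unfolding word_perm_def by simp
qed

lemma word_perm_Nil: "word_perm [] = id"
  by (simp add: word_perm_def)

text \<open>Each letter of a word moves a given point by at most one. So a word that brings \<open>x\<close> to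
  \<open>1\<close> has at least \<open>x - 1\<close> letters, and if it has no more than these then every letter has
  to move the point down, which determines the word. This is what makes the shortest expressions
  below unique, so that the arbitrary choice in \<^const>\<open>shortest_word\<close> has no effect on them.\<close>

lemma word_to_one:
  assumes "word_perm w x = 1"
  shows "x \<le> Suc (length w) \<and> (x = Suc (length w) \<longrightarrow> w = map Suc [0..<length w])"
  using assms
proof (induction w arbitrary: x rule: rev_induct)
  case (snoc i w)
  define y where "y = transpose i (Suc i) x"
  have "word_perm w y = 1" using snoc.prems by (simp add: word_perm_snoc y_def)
  from snoc.IH[OF this]
  have y: "y \<le> Suc (length w)" "y = Suc (length w) \<Longrightarrow> w = map Suc [0..<length w]" by blast+
  have xy: "x \<le> Suc y" "x = Suc y \<Longrightarrow> i = y"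
    unfolding y_def transpose_def by (auto split: if_splits)
  show ?case
  proof (intro conjI impI)
    show "x \<le> Suc (length (w @ [i]))" using y(1) xy by auto
    assume eq: "x = Suc (length (w @ [i]))"
    have "y = Suc (length w)" "i = Suc (length w)" using eq y(1) xy by auto
    moreover from this have "w = map Suc [0..<length w]" using y(2) by blast
    ultimately have "w @ [i] = map Suc [0..<length w] @ [Suc (length w)]" using eq by simp
    then show "w @ [i] = map Suc [0..<length (w @ [i])]" by simp
  qed
qed (simp add: word_perm_Nil)

lemma word_to_top:
  assumes "word_perm w x = n"
  shows "n \<le> x + length w \<and>
    (n = x + length w \<longrightarrow> w = map (\<lambda>i. n - 1 - i) [0..<length w])"
  using assms
proof (induction w arbitrary: x rule: rev_induct)
  case (snoc i w)
  define y where "y = transpose i (Suc i) x"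
  have "word_perm w y = n" using snoc.prems by (simp add: word_perm_snoc y_def)
  from snoc.IH[OF this]
  have y: "n \<le> y + length w" "n = y + length w \<Longrightarrow> w = map (\<lambda>i. n - 1 - i) [0..<length w]" by blast+
  have "y = (if x = i then Suc i else if x = Suc i then i else x)"
    by (simp add: y_def transpose_def)
  then consider "x = i" "y = Suc x" | "x = Suc i" "y = i" | "y = x" by metis
  then have xy: "y \<le> Suc x" "y = Suc x \<Longrightarrow> i = x"
    by (cases; linarith)+
  show ?case
  proof (intro conjI impI)
    show "n \<le> x + length (w @ [i])" using y(1) xy by auto
    assume eq: "n = x + length (w @ [i])"
    have "y = Suc x" "i = x" using eq y(1) xy by auto
    moreover from this eq have "w = map (\<lambda>i. n - 1 - i) [0..<length w]" by (intro y(2)) simp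
    ultimately have "w @ [i] = map (\<lambda>i. n - 1 - i) [0..<length w] @ [(\<lambda>i. n - 1 - i) (length w)]" using eq by simp
    then show "w @ [i] = map (\<lambda>i. n - 1 - i) [0..<length (w @ [i])]" by simp
  qed
qed (simp add: word_perm_Nil)

lemma shortest_word_eqI:
  assumes "set w \<subseteq> {1..<n}"
    and "\<And>v. set v \<subseteq> {1..<n} \<Longrightarrow> word_perm v = word_perm w \<Longrightarrow>
      length w \<le> length v \<and> (length v = length w \<longrightarrow> v = w)"
  shows "shortest_word n (word_perm w) = w"
proof -
  let ?P = "\<lambda>v. set v \<subseteq> {1..<n} \<and> word_perm v = word_perm w"
  have "?P (shortest_word n (word_perm w)) \<and> length (shortest_word n (word_perm w)) \<le> length w"
    unfolding shortest_word_def using arg_min_nat_lemma[of ?P w length] assms(1) by blast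
  with assms(2) show ?thesis by (meson le_antisym)
qed

lemma word_perm_ascending:
  "word_perm (map Suc [0..<k]) x =
     (if x = Suc k then 1 else if 1 \<le> x \<and> x \<le> k then Suc x else x)"
proof (induction k arbitrary: x)
  case (Suc k)
  have "word_perm (map Suc [0..<Suc k]) x = word_perm (map Suc [0..<k]) (transpose (Suc k) (Suc (Suc k)) x)"
    by (simp add: word_perm_snoc)
  then show ?case unfolding Suc.IH by (auto simp: transpose_def)
qed (simp add: word_perm_Nil)

lemma word_perm_descending:
  "k \<le> p \<Longrightarrow> word_perm (map (\<lambda>i. p - i) [0..<k]) x =
     (if x = Suc p - k then Suc p else if Suc p - k < x \<and> x \<le> Suc p then x - 1 else x)"
proof (induction k arbitrary: x)
  case (Suc k)
  have "word_perm (map (\<lambda>i. p - i) [0..<Suc k]) x =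
      word_perm (map (\<lambda>i. p - i) [0..<k]) (transpose (p - k) (Suc (p - k)) x)"
    by (simp add: word_perm_snoc)
  also have "transpose (p - k) (Suc (p - k)) x =
      (if x = p - k then Suc (p - k) else if x = Suc (p - k) then p - k else x)" (is "_ = ?y")
    by (simp add: transpose_def)
  also have "word_perm (map (\<lambda>i. p - i) [0..<k]) ?y =
      (if ?y = Suc p - k then Suc p else if Suc p - k < ?y \<and> ?y \<le> Suc p then ?y - 1 else ?y)"
    using Suc.prems by (intro Suc.IH) simp
  also have "\<dots> = (if x = Suc p - Suc k then Suc p
      else if Suc p - Suc k < x \<and> x \<le> Suc p then x - 1 else x)"
  proof -
    consider "x = p - k" | "x = Suc (p - k)" | "x < p - k" | "x > Suc (p - k)" by linarith
    then show ?thesis using Suc.prems by cases (simp_all add: Suc_diff_le)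
  qed
  finally show ?case .
qed (simp add: word_perm_Nil)

lemma shortest_word_ascending:
  "k \<le> q \<Longrightarrow> shortest_word (Suc q) (word_perm (map Suc [0..<k])) = map Suc [0..<k]"
proof (rule shortest_word_eqI)
  fix v assume "word_perm v = word_perm (map Suc [0..<k])"
  then have "word_perm v (Suc k) = 1" by (simp add: word_perm_ascending)
  from word_to_one[OF this]
  show "length (map Suc [0..<k]) \<le> length v \<and> (length v = length (map Suc [0..<k]) \<longrightarrow> v = map Suc [0..<k])"
    by auto
qed auto

lemma shortest_word_descending:
  "k \<le> p \<Longrightarrow> shortest_word (Suc p) (word_perm (map (\<lambda>i. p - i) [0..<k])) = map (\<lambda>i. p - i) [0..<k]"
proof (rule shortest_word_eqI)
  fix v assume k: "k \<le> p" "word_perm v = word_perm (map (\<lambda>i. p - i) [0..<k])"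
  then have "word_perm v (Suc p - k) = Suc p" by (simp add: word_perm_descending)
  from word_to_top[OF this] k
  show "length (map (\<lambda>i. p - i) [0..<k]) \<le> length v \<and>
      (length v = length (map (\<lambda>i. p - i) [0..<k]) \<longrightarrow> v = map (\<lambda>i. p - i) [0..<k])"
    by auto
qed auto

lemma word_perm_permutes: "set w \<subseteq> {1..<n} \<Longrightarrow> word_perm w permutes {1..n}"
proof (induction w rule: rev_induct)
  case (snoc i w)
  then show ?case
    unfolding word_perm_snoc
    by (intro permutes_compose[OF permutes_swap_id]) auto
qed (simp add: word_perm_Nil permutes_id)

lemma strict_mono_on_eqI:
  fixes f g :: "nat \<Rightarrow> nat"
  assumes "strict_mono_on {m..n} f" "strict_mono_on {m..n} g" "f ` {m..n} = g ` {m..n}" "i \<in> {m..n}"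
  shows "f i = g i"
proof -
  have *: "sorted (map h [m..<Suc n]) \<and> distinct (map h [m..<Suc n])"
    if h: "strict_mono_on {m..n} h" for h :: "nat \<Rightarrow> nat"
  proof
    show "sorted (map h [m..<Suc n])"
      unfolding sorted_map
      by (rule sorted_wrt_mono_rel[OF _ sorted_wrt_upt])
         (auto intro!: less_imp_le[OF strict_mono_onD[OF h]] simp del: upt_Suc)
    show "distinct (map h [m..<Suc n])"
      using strict_mono_on_imp_inj_on[OF h]
      by (simp add: distinct_map atLeastLessThanSuc_atLeastAtMost del: upt_Suc)
  qed
  have "map f [m..<Suc n] = map g [m..<Suc n]"
    using *[OF assms(1)] *[OF assms(2)] assms(3)
    by (intro sorted_distinct_set_unique)
       (auto simp: atLeastLessThanSuc_atLeastAtMost simp del: upt_Suc)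
  with assms(4) show ?thesis by (simp add: map_eq_conv del: upt_Suc)
qed

text \<open>A shuffle is increasing on both blocks, so it is determined by the positions that the first
  block occupies.\<close>

lemma Sh_eqI:
  assumes s: "s \<in> Sh p q" and t: "t \<in> Sh p q" and eq: "s ` {1..p} = t ` {1..p}"
  shows "s = t"
proof
  fix i
  have perm: "s permutes {1..p + q}" "t permutes {1..p + q}"
    using s t by (auto simp: Sh_def)
  have split: "{1..p + q} - {1..p} = {p + 1..p + q}" by auto
  have "s ` ({1..p + q} - {1..p}) = t ` ({1..p + q} - {1..p})"
    using permutes_image[OF perm(1)] permutes_image[OF perm(2)] eq
    by (simp add: image_set_diff permutes_inj[OF perm(1)] permutes_inj[OF perm(2)])
  then have eq': "s ` {p + 1..p + q} = t ` {p + 1..p + q}" unfolding split .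
  consider "i \<in> {1..p}" | "i \<in> {p + 1..p + q}" | "i \<notin> {1..p + q}" by force
  then show "s i = t i"
  proof cases
    case 1
    then show ?thesis using strict_mono_on_eqI[OF _ _ eq] s t by (auto simp: Sh_def)
  next
    case 2
    then show ?thesis using strict_mono_on_eqI[OF _ _ eq'] s t by (auto simp: Sh_def)
  next
    case 3
    then show ?thesis using perm by (auto simp: permutes_def)
  qed
qed

lemma strict_mono_onI_inv:
  fixes s t :: "nat \<Rightarrow> nat"
  assumes "\<And>i. t (s i) = i" "\<And>i. i \<in> A \<Longrightarrow> s i \<in> B" "\<And>x y. x \<in> B \<Longrightarrow> y \<in> B \<Longrightarrow> x \<le> y \<Longrightarrow> t x \<le> t y"
  shows "strict_mono_on A s"
proof (rule strict_mono_onI)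
  fix i j assume "i \<in> A" "j \<in> A" "i < j"
  then show "s i < s j" using assms by (metis linorder_not_le)
qed

text \<open>The inverse of a shuffle with a first block of one element is the cycle that carries some
  position to the front, hence given by an ascending word.\<close>

lemma bij_betw_Sh_ascending:
  "bij_betw (\<lambda>k. Hilbert_Choice.inv (word_perm (map Suc [0..<k]))) {..q} (Sh 1 q)"
proof -
  define t where "t k = word_perm (map Suc [0..<k])" for k
  define s where "s k = Hilbert_Choice.inv (t k)" for k
  have t: "t k permutes {1..1 + q}" if "k \<le> q" for k
    unfolding t_def using that by (intro word_perm_permutes) auto
  have s1: "s k 1 = Suc k" if "k \<le> q" for k
    unfolding s_def by (rule inv_f_eq[OF permutes_inj[OF t[OF that]]]) (simp add: t_def word_perm_ascending)
  have mem: "s k \<in> Sh 1 q" if k: "k \<le> q" for k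
    unfolding Sh_def
  proof (intro CollectI conjI)
    show perm: "s k permutes {1..1 + q}" unfolding s_def using t[OF k] by (rule permutes_inv)
    show "strict_mono_on {1..1} (s k)" by (auto intro: strict_mono_onI)
    have ne: "s k i \<noteq> Suc k" if "i \<noteq> 1" for i
      using s1[OF k] permutes_inj[OF perm] that by (metis injD)
    show "strict_mono_on {1 + 1..1 + q} (s k)"
    proof (rule strict_mono_onI_inv[of "t k" _ _ "{1..} - {Suc k}"])
      show "t k (s k i) = i" for i unfolding s_def using permutes_inverses[OF t[OF k]] by simp
      show "s k i \<in> {1..} - {Suc k}" if "i \<in> {1 + 1..1 + q}" for i
        using ne[of i] that permutes_in_image[OF perm, of i] by auto
    qed (auto simp: t_def word_perm_ascending)
  qed
  have inj: "inj_on s {..q}"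
    by (rule inj_onI) (metis atMost_iff s1 nat.inject)
  have "u \<in> s ` {..q}" if u: "u \<in> Sh 1 q" for u
  proof -
    have "u 1 \<in> {1..1 + q}"
      using u permutes_in_image[of u "{1..1 + q}" 1] by (simp add: Sh_def)
    then obtain k where k: "u 1 = Suc k" "k \<le> q" by (cases "u 1") auto
    then have "u = s k" using s1 by (intro Sh_eqI[OF u mem]) auto
    with k show ?thesis by auto
  qed
  with inj mem have "bij_betw s {..q} (Sh 1 q)"
    unfolding bij_betw_def by auto
  then show ?thesis unfolding s_def t_def .
qed

lemma bij_betw_Sh_descending:
  "bij_betw (\<lambda>k. Hilbert_Choice.inv (word_perm (map (\<lambda>i. p - i) [0..<k]))) {..p} (Sh p 1)"
proof -
  define t where "t k = word_perm (map (\<lambda>i. p - i) [0..<k])" for k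
  define s where "s k = Hilbert_Choice.inv (t k)" for k
  have t: "t k permutes {1..p + 1}" if "k \<le> p" for k
    unfolding t_def using that by (intro word_perm_permutes) auto
  have s1: "s k (Suc p) = Suc p - k" if "k \<le> p" for k
    unfolding s_def
    by (rule inv_f_eq[OF permutes_inj[OF t[OF that]]]) (simp add: t_def word_perm_descending that)
  have mem: "s k \<in> Sh p 1" if k: "k \<le> p" for k
    unfolding Sh_def
  proof (intro CollectI conjI)
    show perm: "s k permutes {1..p + 1}" unfolding s_def using t[OF k] by (rule permutes_inv)
    show "strict_mono_on {p + 1..p + 1} (s k)" by (auto intro: strict_mono_onI)
    have ne: "s k i \<noteq> Suc p - k" if "i \<noteq> Suc p" for i
      using s1[OF k] permutes_inj[OF perm] that by (metis injD)
    show "strict_mono_on {1..p} (s k)"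
    proof (rule strict_mono_onI_inv[of "t k" _ _ "{..Suc p} - {Suc p - k}"])
      show "t k (s k i) = i" for i unfolding s_def using permutes_inverses[OF t[OF k]] by simp
      show "s k i \<in> {..Suc p} - {Suc p - k}" if "i \<in> {1..p}" for i
        using ne[of i] that permutes_in_image[OF perm, of i] by auto
    qed (use k in \<open>auto simp: t_def word_perm_descending\<close>)
  qed
  have inj: "inj_on s {..p}"
  proof (rule inj_onI)
    fix j k assume "j \<in> {..p}" "k \<in> {..p}" "s j = s k"
    then show "j = k" using s1[of j] s1[of k] by auto
  qed
  have "u \<in> s ` {..p}" if u: "u \<in> Sh p 1" for u
  proof -
    have perm: "u permutes {1..Suc p}" using u by (simp add: Sh_def)
    then have "u (Suc p) \<in> {1..Suc p}"
      using permutes_in_image[of u "{1..Suc p}" "Suc p"] by simp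
    then have k: "u (Suc p) = Suc p - (Suc p - u (Suc p))" "Suc p - u (Suc p) \<le> p" by auto
    define k where "k = Suc p - u (Suc p)"
    have k: "u (Suc p) = s k (Suc p)" "k \<le> p" using k s1[of k] unfolding k_def by auto
    have perm': "s k permutes {1..Suc p}" using mem[OF k(2)] by (simp add: Sh_def)
    have split: "{1..p} = {1..Suc p} - {Suc p}" by auto
    have "u ` {1..p} = s k ` {1..p}"
      unfolding split image_set_diff[OF permutes_inj[OF perm]] image_set_diff[OF permutes_inj[OF perm']]
      using permutes_image[OF perm] permutes_image[OF perm'] k(1) by simp
    then have "u = s k" by (rule Sh_eqI[OF u mem[OF k(2)]])
    with k show ?thesis by auto
  qed
  with inj mem have "bij_betw s {..p} (Sh p 1)"
    unfolding bij_betw_def by auto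
  then show ?thesis unfolding s_def t_def .
qed

section \<open>Typing in symmetric preadditive strict monoidal categories\<close>

definition end_ring :: "('o, 'a, 'x) moncat_scheme \<Rightarrow> 'o \<Rightarrow> 'a ring" where
  "end_ring C X = \<lparr>carrier = Hom C X X, monoid.mult = Comp C, one = Id C X,
     zero = Zero C X X, add = Plus C\<rparr>"

lemma end_ring_simps:
  "carrier (end_ring C X) = Hom C X X" "f \<otimes>\<^bsub>end_ring C X\<^esub> g = f \<cdot>\<^bsub>C\<^esub> g"
  "\<one>\<^bsub>end_ring C X\<^esub> = Id C X" "\<zero>\<^bsub>end_ring C X\<^esub> = Zero C X X"
  "f \<oplus>\<^bsub>end_ring C X\<^esub> g = Plus C f g"
  by (simp_all add: end_ring_def)

lemma hom_group_simps:
  "carrier (hom_group C X Y) = Hom C X Y" "f \<otimes>\<^bsub>hom_group C X Y\<^esub> g = Plus C f g"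
  "\<one>\<^bsub>hom_group C X Y\<^esub> = Zero C X Y"
  by (simp_all add: hom_group_def)

text \<open>Domains and codomains that simplify by themselves let the simplifier discharge the typing
  conditions of the category axioms, whose intermediate objects it could not guess from
  membership in a hom-set.\<close>

lemma Hom_iff: "f \<in> Hom C X Y \<longleftrightarrow> f \<in> Arr C \<and> Dom C f = X \<and> Cod C f = Y"
  by (simp add: Hom_def)

context symmetric_preadditive_strict_monoidal_category
begin

lemma Id_typing:
  assumes "X \<in> Obj C"
  shows "Id C X \<in> Arr C" "Dom C (Id C X) = X" "Cod C (Id C X) = X"
  using Id_Hom[OF assms] by (auto simp: Hom_iff)

lemma Comp_typing:
  assumes "f \<in> Arr C" "g \<in> Arr C" "Dom C g = Cod C f"
  shows "g \<cdot> f \<in> Arr C" "Dom C (g \<cdot> f) = Dom C f" "Cod C (g \<cdot> f) = Cod C g"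
  using Comp_Hom[of f "Dom C f" "Cod C f" g "Cod C g"] assms by (auto simp: Hom_iff)

lemma TensorA_typing:
  assumes "f \<in> Arr C" "g \<in> Arr C"
  shows "f \<otimes>\<^sub>a g \<in> Arr C" "Dom C (f \<otimes>\<^sub>a g) = Dom C f \<otimes>\<^sub>o Dom C g"
    "Cod C (f \<otimes>\<^sub>a g) = Cod C f \<otimes>\<^sub>o Cod C g"
  using TensorA_Hom[of f "Dom C f" "Cod C f" g "Dom C g" "Cod C g"] assms by (auto simp: Hom_iff)

lemma Braid_typing:
  assumes "X \<in> Obj C" "Y \<in> Obj C"
  shows "Braid C X Y \<in> Arr C" "Dom C (Braid C X Y) = X \<otimes>\<^sub>o Y" "Cod C (Braid C X Y) = Y \<otimes>\<^sub>o X"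
  using Braid_Hom[OF assms] by (auto simp: Hom_iff)

lemma Plus_Hom:
  assumes "f \<in> Hom C X Y" "g \<in> Hom C X Y"
  shows "Plus C f g \<in> Hom C X Y"
proof -
  have "X \<in> Obj C" "Y \<in> Obj C" using assms Dom_Obj Cod_Obj by (auto simp: Hom_iff)
  then interpret G: comm_group "hom_group C X Y" by (rule hom_comm_group)
  show ?thesis using G.m_closed[of f g] assms by (simp add: hom_group_simps)
qed

lemma Plus_typing:
  assumes "f \<in> Arr C" "g \<in> Arr C" "Dom C f = Dom C g" "Cod C f = Cod C g"
  shows "Plus C f g \<in> Arr C" "Dom C (Plus C f g) = Dom C g" "Cod C (Plus C f g) = Cod C g"
  using Plus_Hom[of f "Dom C g" "Cod C g" g] assms by (auto simp: Hom_iff)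

lemma Zero_Hom: "X \<in> Obj C \<Longrightarrow> Y \<in> Obj C \<Longrightarrow> Zero C X Y \<in> Hom C X Y"
  using group.is_monoid[OF comm_group.axioms(2)[OF hom_comm_group]] monoid.one_closed
  by (fastforce simp: hom_group_simps)

lemma Zero_typing:
  assumes "X \<in> Obj C" "Y \<in> Obj C"
  shows "Zero C X Y \<in> Arr C" "Dom C (Zero C X Y) = X" "Cod C (Zero C X Y) = Y"
  using Zero_Hom[OF assms] by (auto simp: Hom_iff)

lemma neg_Hom:
  assumes "f \<in> Hom C X Y"
  shows "neg C f \<in> Hom C X Y" "Plus C f (neg C f) = Zero C X Y"
proof -
  have XY: "X \<in> Obj C" "Y \<in> Obj C" "Dom C f = X" "Cod C f = Y"
    using assms Dom_Obj Cod_Obj by (auto simp: Hom_iff)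
  then interpret G: comm_group "hom_group C X Y" by (intro hom_comm_group)
  show "neg C f \<in> Hom C X Y" "Plus C f (neg C f) = Zero C X Y"
    using G.inv_closed[of f] G.r_inv[of f] assms XY by (simp_all add: neg_def hom_group_simps)
qed

lemma neg_typing:
  assumes "f \<in> Arr C"
  shows "neg C f \<in> Arr C" "Dom C (neg C f) = Dom C f" "Cod C (neg C f) = Cod C f"
  using neg_Hom(1)[of f "Dom C f" "Cod C f"] assms by (auto simp: Hom_iff)

lemmas typing = Id_typing Comp_typing TensorA_typing Braid_typing Plus_typing Zero_typing
  neg_typing TensorO_Obj Unit_Obj Dom_Obj Cod_Obj TensorO_assoc TensorO_Unit_left TensorO_Unit_right

declare typing [simp]

lemma comp_Id [simp]:
  "f \<in> Arr C \<Longrightarrow> Cod C f = X \<Longrightarrow> Id C X \<cdot> f = f"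
  "f \<in> Arr C \<Longrightarrow> Dom C f = X \<Longrightarrow> f \<cdot> Id C X = f"
  using Comp_Id_left Comp_Id_right by (auto simp: Hom_iff)

lemma comp_assoc:
  "f \<in> Arr C \<Longrightarrow> g \<in> Arr C \<Longrightarrow> h \<in> Arr C \<Longrightarrow> Dom C g = Cod C f \<Longrightarrow> Dom C h = Cod C g
    \<Longrightarrow> (h \<cdot> g) \<cdot> f = h \<cdot> (g \<cdot> f)"
  using Comp_assoc by (auto simp: Hom_iff)

lemma interchange:
  "f \<in> Arr C \<Longrightarrow> f' \<in> Arr C \<Longrightarrow> g \<in> Arr C \<Longrightarrow> g' \<in> Arr C \<Longrightarrow> Dom C f' = Cod C f \<Longrightarrow> Dom C g' = Cod C g
    \<Longrightarrow> (f' \<otimes>\<^sub>a g') \<cdot> (f \<otimes>\<^sub>a g) = (f' \<cdot> f) \<otimes>\<^sub>a (g' \<cdot> g)"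
  using TensorA_Comp by (auto simp: Hom_iff)

lemma slide:
  assumes "f \<in> Hom C X X'" "g \<in> Hom C Y Y'"
  shows "(Id C X' \<otimes>\<^sub>a g) \<cdot> (f \<otimes>\<^sub>a Id C Y) = (f \<otimes>\<^sub>a Id C Y') \<cdot> (Id C X \<otimes>\<^sub>a g)"
  using assms by (auto simp: interchange Hom_iff)

section \<open>Additivity\<close>

lemma double_zero:
  assumes "f \<in> Hom C X Y" "Plus C f f = f"
  shows "f = Zero C X Y"
proof -
  have XY: "X \<in> Obj C" "Y \<in> Obj C" using assms(1) Dom_Obj Cod_Obj by (auto simp: Hom_iff)
  then interpret G: comm_group "hom_group C X Y" by (intro hom_comm_group)
  show ?thesis using G.l_cancel_one[of f f] assms by (simp add: hom_group_simps)
qed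

lemma Plus_Zero: 
  assumes "f \<in> Hom C X Y"
  shows "Plus C (Zero C X Y) f = f" "Plus C f (Zero C X Y) = f"
proof -
  have XY: "X \<in> Obj C" "Y \<in> Obj C" using assms(1) Dom_Obj Cod_Obj by (auto simp: Hom_iff)
  then interpret G: comm_group "hom_group C X Y" by (intro hom_comm_group)
  show "Plus C (Zero C X Y) f = f" "Plus C f (Zero C X Y) = f"
    using G.l_one[of f] G.r_one[of f] assms by (simp_all add: hom_group_simps)
qed

lemma Zero_Comp:
  assumes "f \<in> Hom C X Y" "Z \<in> Obj C"
  shows "Zero C Y Z \<cdot> f = Zero C X Z"
proof (rule double_zero)
  have Y: "Y \<in> Obj C" using assms by (auto simp: Hom_iff)
  show "Zero C Y Z \<cdot> f \<in> Hom C X Z" using assms Zero_Hom[OF Y assms(2)] Comp_Hom by blast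
  show "Plus C (Zero C Y Z \<cdot> f) (Zero C Y Z \<cdot> f) = Zero C Y Z \<cdot> f"
    using Comp_Plus_left[OF assms(1) Zero_Hom[OF Y assms(2)] Zero_Hom[OF Y assms(2)]]
      Plus_Zero[OF Zero_Hom[OF Y assms(2)]] by simp
qed

lemma Comp_Zero:
  assumes "f \<in> Hom C Y Z" "X \<in> Obj C"
  shows "f \<cdot> Zero C X Y = Zero C X Z"
proof (rule double_zero)
  have Y: "Y \<in> Obj C" using assms by (auto simp: Hom_iff)
  show "f \<cdot> Zero C X Y \<in> Hom C X Z" using assms Zero_Hom[OF assms(2) Y] Comp_Hom by blast
  show "Plus C (f \<cdot> Zero C X Y) (f \<cdot> Zero C X Y) = f \<cdot> Zero C X Y"
    using Comp_Plus_right[OF Zero_Hom[OF assms(2) Y] Zero_Hom[OF assms(2) Y] assms(1)]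
      Plus_Zero[OF Zero_Hom[OF assms(2) Y]] by simp
qed

lemma TensorA_Zero:
  assumes "f \<in> Hom C X X'" "Y \<in> Obj C" "Y' \<in> Obj C"
  shows "f \<otimes>\<^sub>a Zero C Y Y' = Zero C (X \<otimes>\<^sub>o Y) (X' \<otimes>\<^sub>o Y')"
    "Zero C Y Y' \<otimes>\<^sub>a f = Zero C (Y \<otimes>\<^sub>o X) (Y' \<otimes>\<^sub>o X')"
  using TensorA_Plus_right[OF assms(1) Zero_Hom Zero_Hom] TensorA_Plus_left[OF Zero_Hom Zero_Hom assms(1)]
    TensorA_Hom[OF assms(1) Zero_Hom] TensorA_Hom[OF Zero_Hom assms(1)]
    Plus_Zero[OF Zero_Hom] assms(2,3)
  by (auto intro!: double_zero)

lemma negI: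
  assumes "f \<in> Hom C X Y" "g \<in> Hom C X Y" "Plus C f g = Zero C X Y"
  shows "g = neg C f"
proof -
  have XY: "X \<in> Obj C" "Y \<in> Obj C" "Dom C f = X" "Cod C f = Y"
    using assms Dom_Obj Cod_Obj by (auto simp: Hom_iff)
  then interpret G: comm_group "hom_group C X Y" by (intro hom_comm_group)
  show ?thesis using G.inv_equality[of g f] G.m_comm[of f g] assms XY
    by (simp add: neg_def hom_group_simps)
qed

lemma Comp_neg:
  assumes "f \<in> Hom C X Y" "g \<in> Hom C Y Z"
  shows "g \<cdot> neg C f = neg C (g \<cdot> f)" "neg C g \<cdot> f = neg C (g \<cdot> f)"
proof -
  have o: "X \<in> Obj C" "Z \<in> Obj C" using assms by (auto simp: Hom_iff)
  show "g \<cdot> neg C f = neg C (g \<cdot> f)"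
    using Comp_Plus_right[OF assms(1) neg_Hom(1)[OF assms(1)] assms(2)] neg_Hom[OF assms(1)] assms
      Comp_Zero[OF assms(2) o(1)] Comp_Hom by (intro negI[of _ X Z]) auto
  show "neg C g \<cdot> f = neg C (g \<cdot> f)"
    using Comp_Plus_left[OF assms neg_Hom(1)[OF assms(2)]] neg_Hom[OF assms(2)] assms
      Zero_Comp[OF assms(1) o(2)] Comp_Hom by (intro negI[of _ X Z]) auto
qed

lemma TensorA_neg:
  assumes "f \<in> Hom C X X'" "g \<in> Hom C Y Y'"
  shows "f \<otimes>\<^sub>a neg C g = neg C (f \<otimes>\<^sub>a g)" "neg C f \<otimes>\<^sub>a g = neg C (f \<otimes>\<^sub>a g)"
proof -
  have o: "X \<in> Obj C" "X' \<in> Obj C" "Y \<in> Obj C" "Y' \<in> Obj C" using assms by (auto simp: Hom_iff)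
  show "f \<otimes>\<^sub>a neg C g = neg C (f \<otimes>\<^sub>a g)"
    using TensorA_Plus_right[OF assms neg_Hom(1)[OF assms(2)]] neg_Hom[OF assms(2)] assms
      TensorA_Zero(1)[OF assms(1) o(3,4)] TensorA_Hom by (intro negI[of _ "X \<otimes>\<^sub>o Y" "X' \<otimes>\<^sub>o Y'"]) auto
  show "neg C f \<otimes>\<^sub>a g = neg C (f \<otimes>\<^sub>a g)"
    using TensorA_Plus_left[OF assms(1) neg_Hom(1)[OF assms(1)] assms(2)] neg_Hom[OF assms(1)] assms
      TensorA_Zero(2)[OF assms(2) o(1,2)] TensorA_Hom by (intro negI[of _ "X \<otimes>\<^sub>o Y" "X' \<otimes>\<^sub>o Y'"]) auto
qed

lemma neg_neg: "f \<in> Hom C X Y \<Longrightarrow> neg C (neg C f) = f"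
proof -
  assume f: "f \<in> Hom C X Y"
  have XY: "X \<in> Obj C" "Y \<in> Obj C" "Dom C f = X" "Cod C f = Y" "f \<in> Arr C"
    using f Dom_Obj Cod_Obj by (auto simp: Hom_iff)
  then interpret G: comm_group "hom_group C X Y" by (intro hom_comm_group)
  show ?thesis using G.inv_inv[of f] f XY by (simp add: neg_def[of _ "neg C f"]) (simp add: neg_def hom_group_simps)
qed

text \<open>Integer multiples occur in the differentials only as signs.\<close>

lemma scale_sign:
  assumes "f \<in> Hom C X Y"
  shows "scale C ((-1) ^ n) f = (if even n then f else neg C f)"
proof -
  have XY: "X \<in> Obj C" "Y \<in> Obj C" "Dom C f = X" "Cod C f = Y"
    using assms Dom_Obj Cod_Obj by (auto simp: Hom_iff)
  then interpret G: comm_group "hom_group C X Y" by (intro hom_comm_group)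
  show ?thesis
    using assms XY G.int_pow_1[of f] G.int_pow_neg[of f 1] by (auto simp: scale_def neg_def hom_group_simps)
qed

section \<open>Endomorphism rings\<close>

lemma ring_end_ring:
  assumes X: "X \<in> Obj C"
  shows "ring (end_ring C X)"
proof (rule ringI)
  have "add_monoid (end_ring C X) = hom_group C X X"
    by (simp add: end_ring_def hom_group_def)
  then show "abelian_group (end_ring C X)"
    using hom_comm_group[OF X X] by (intro comm_group_abelian_groupI) simp
  show "monoid (end_ring C X)"
    by (rule monoidI) (use X in \<open>auto simp: end_ring_simps Hom_iff comp_assoc\<close>)
qed (use Comp_Plus_left Comp_Plus_right in \<open>auto simp: end_ring_simps\<close>)

lemma whisker_left_hom:
  assumes "X \<in> Obj C" "Y \<in> Obj C"
  shows "(\<lambda>f. Id C Y \<otimes>\<^sub>a f) \<in> ring_hom (end_ring C X) (end_ring C (Y \<otimes>\<^sub>o X))"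
  using assms TensorA_Plus_right[OF Id_Hom]
  by (intro ring_hom_memI) (auto simp: end_ring_simps Hom_iff interchange TensorA_Id)

lemma whisker_right_hom:
  assumes "X \<in> Obj C" "Y \<in> Obj C"
  shows "(\<lambda>f. f \<otimes>\<^sub>a Id C Y) \<in> ring_hom (end_ring C X) (end_ring C (X \<otimes>\<^sub>o Y))"
  using assms TensorA_Plus_left[OF _ _ Id_Hom]
  by (intro ring_hom_memI) (auto simp: end_ring_simps Hom_iff interchange TensorA_Id)

section \<open>Crossings on tensor powers\<close>

lemma tpow_Obj [simp]: "V \<in> Obj C \<Longrightarrow> tpow C V n \<in> Obj C"
  by (induction n) auto

lemma tpow_add: "V \<in> Obj C \<Longrightarrow> tpow C V m \<otimes>\<^sub>o tpow C V n = tpow C V (m + n)"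
  by (induction m) auto

lemma tpow_snoc: "V \<in> Obj C \<Longrightarrow> tpow C V n \<otimes>\<^sub>o V = V \<otimes>\<^sub>o tpow C V n"
  using tpow_add[of V n 1] by simp

lemma on_strands_Hom:
  assumes "V \<in> Obj C" "\<beta> \<in> Hom C (V \<otimes>\<^sub>o V) (V \<otimes>\<^sub>o V)" "1 \<le> i" "i < n"
  shows "on_strands C V n \<beta> i \<in> Hom C (tpow C V n) (tpow C V n)"
proof -
  have e: "i - 1 + (Suc (Suc 0) + (n - (i + 1))) = n" using assms by simp
  have "tpow C V (i - 1) \<otimes>\<^sub>o ((V \<otimes>\<^sub>o V) \<otimes>\<^sub>o tpow C V (n - (i + 1))) = tpow C V n"
    using tpow_add[of V "i - 1" "Suc (Suc 0) + (n - (i + 1))", unfolded e] assms(1) by simp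
  then show ?thesis
    using TensorA_Hom[OF Id_Hom TensorA_Hom[OF assms(2) Id_Hom], of "tpow C V (i - 1)"
        "tpow C V (n - (i + 1))"] assms(1)
    unfolding on_strands_def by (simp del: TensorO_assoc)
qed

text \<open>Adding \<open>p\<close> strands on the left and \<open>q\<close> strands on the right shifts the position of a
  crossing by \<open>p\<close>.\<close>

lemma on_strands_whisker:
  assumes "V \<in> Obj C" "\<beta> \<in> Hom C (V \<otimes>\<^sub>o V) (V \<otimes>\<^sub>o V)" "1 \<le> i" "i < n"
  shows "on_strands C V (p + n + q) \<beta> (p + i) =
    Id C (tpow C V p) \<otimes>\<^sub>a on_strands C V n \<beta> i \<otimes>\<^sub>a Id C (tpow C V q)"
proof -
  have e: "p + i - 1 = p + (i - 1)" "p + n + q - (p + i + 1) = (n - (i + 1)) + q"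
    using assms by auto
  have "\<beta> \<in> Arr C" using assms by (simp add: Hom_iff)
  then show ?thesis
    unfolding on_strands_def e using assms(1)
    by (simp add: tpow_add[symmetric] TensorA_Id[symmetric] TensorA_assoc)
qed

text \<open>Distant crossings commute because they act on different tensor factors; the braid relation is the
  one on three strands, with further strands on both sides.\<close>

lemma braid_family_on_strands:
  assumes "pre_braided_object C V \<beta>"
  shows "braid_family (end_ring C (tpow C V (Suc k))) (\<lambda>i. on_strands C V (Suc k) \<beta> (Suc i)) k"
proof -
  have V: "V \<in> Obj C" and \<beta>: "\<beta> \<in> Hom C (V \<otimes>\<^sub>o V) (V \<otimes>\<^sub>o V)"
    and br: "on_strands C V 3 \<beta> 1 \<cdot> on_strands C V 3 \<beta> 2 \<cdot> on_strands C V 3 \<beta> 1 =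
     on_strands C V 3 \<beta> 2 \<cdot> on_strands C V 3 \<beta> 1 \<cdot> on_strands C V 3 \<beta> 2"
    using assms by (auto simp: pre_braided_object_def)
  note H = on_strands_Hom[OF V \<beta>]
  note W = on_strands_whisker[OF V \<beta>]
  show ?thesis
    unfolding braid_family_def
  proof (intro conjI allI impI)
    fix i assume "i < k"
    then show "on_strands C V (Suc k) \<beta> (Suc i) \<in> carrier (end_ring C (tpow C V (Suc k)))"
      unfolding end_ring_simps by (intro H) auto
  next
    fix i j assume ij: "i + 1 < j \<and> j < k"
    then obtain d where d: "j = i + 2 + d" using less_iff_Suc_add by auto
    obtain e where e: "Suc k = j + 2 + e" using ij less_iff_Suc_add by auto
    let ?n = "Suc k"
    have f: "on_strands C V (Suc k) \<beta> (Suc i) =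
        on_strands C V (i + 2) \<beta> (i + 1) \<otimes>\<^sub>a Id C (tpow C V (d + 2 + e))"
      using W[of "i + 1" "i + 2" 0 "d + 2 + e"] H[of "i + 1" "i + 2"] V d e
      by (auto simp: TensorA_Unit_left Hom_iff add_ac simp del: tpow.simps(2))
    have g: "on_strands C V (Suc k) \<beta> (Suc j) =
        Id C (tpow C V (i + 2)) \<otimes>\<^sub>a on_strands C V (d + 2 + e) \<beta> (d + 1)"
      using W[of "d + 1" "d + 2 + e" "i + 2" 0] H[of "d + 1" "d + 2 + e"] V d e
      by (auto simp: TensorA_Unit_right Hom_iff add_ac simp del: tpow.simps(2))
    show "on_strands C V (Suc k) \<beta> (Suc i) \<otimes>\<^bsub>end_ring C (tpow C V (Suc k))\<^esub> on_strands C V (Suc k) \<beta> (Suc j) =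
      on_strands C V (Suc k) \<beta> (Suc j) \<otimes>\<^bsub>end_ring C (tpow C V (Suc k))\<^esub> on_strands C V (Suc k) \<beta> (Suc i)"
      unfolding f g end_ring_simps
      using slide[OF H[of "i + 1" "i + 2"] H[of "d + 1" "d + 2 + e"]] by simp
  next
    fix i assume i: "i + 1 < k"
    then obtain e where e: "Suc k = i + 3 + e" using less_iff_Suc_add by auto
    let ?h = "\<lambda>f. Id C (tpow C V i) \<otimes>\<^sub>a f \<otimes>\<^sub>a Id C (tpow C V e)"
    have f: "on_strands C V (Suc k) \<beta> (Suc i) = ?h (on_strands C V 3 \<beta> 1)"
      using W[of 1 3 i e] unfolding e[symmetric] by simp
    have g: "on_strands C V (Suc k) \<beta> (Suc (i + 1)) = ?h (on_strands C V 3 \<beta> 2)"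
      using W[of 2 3 i e] unfolding e[symmetric] by simp
    have h: "?h x \<cdot> ?h y \<cdot> ?h z = ?h (x \<cdot> y \<cdot> z)"
      if "x \<in> Hom C X X" "y \<in> Hom C X X" "z \<in> Hom C X X" for x y z X
      using that V by (auto simp: Hom_iff interchange)
    show "on_strands C V (Suc k) \<beta> (Suc i) \<otimes>\<^bsub>end_ring C (tpow C V (Suc k))\<^esub>
      (on_strands C V (Suc k) \<beta> (Suc (i + 1)) \<otimes>\<^bsub>end_ring C (tpow C V (Suc k))\<^esub> on_strands C V (Suc k) \<beta> (Suc i)) =
      on_strands C V (Suc k) \<beta> (Suc (i + 1)) \<otimes>\<^bsub>end_ring C (tpow C V (Suc k))\<^esub>
      (on_strands C V (Suc k) \<beta> (Suc i) \<otimes>\<^bsub>end_ring C (tpow C V (Suc k))\<^esub> on_strands C V (Suc k) \<beta> (Suc (i + 1)))"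
      unfolding f g end_ring_simps using H[of 1 3] H[of 2 3] br by (simp add: h)
  qed
qed

text \<open>Both sides of the braid relation are cubic, so both change sign.\<close>

lemma pre_braided_neg:
  assumes "pre_braided_object C V \<sigma>"
  shows "pre_braided_object C V (neg C \<sigma>)"
proof -
  have V: "V \<in> Obj C" and \<sigma>: "\<sigma> \<in> Hom C (V \<otimes>\<^sub>o V) (V \<otimes>\<^sub>o V)"
    and br: "on_strands C V 3 \<sigma> 1 \<cdot> on_strands C V 3 \<sigma> 2 \<cdot> on_strands C V 3 \<sigma> 1 =
     on_strands C V 3 \<sigma> 2 \<cdot> on_strands C V 3 \<sigma> 1 \<cdot> on_strands C V 3 \<sigma> 2"
    using assms by (auto simp: pre_braided_object_def)
  have n: "on_strands C V 3 (neg C \<sigma>) i = neg C (on_strands C V 3 \<sigma> i)" for i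
    unfolding on_strands_def
    using V \<sigma> TensorA_neg(2)[OF \<sigma> Id_Hom[OF tpow_Obj[OF V]]]
      TensorA_neg(1)[OF Id_Hom[OF tpow_Obj[OF V]] TensorA_Hom[OF \<sigma> Id_Hom[OF tpow_Obj[OF V]]]]
    by simp
  have nnn: "neg C x \<cdot> neg C y \<cdot> neg C z = neg C (x \<cdot> y \<cdot> z)"
    if "x \<in> Hom C X X" "y \<in> Hom C X X" "z \<in> Hom C X X" for x y z X
  proof -
    have yz: "y \<cdot> z \<in> Hom C X X" using Comp_Hom that by blast
    have "neg C y \<cdot> neg C z = y \<cdot> z"
      using Comp_neg(2)[OF neg_Hom(1) that(2)] Comp_neg(1)[OF that(3,2)] neg_neg[OF yz] that by simp
    then show ?thesis using Comp_neg(2)[OF yz that(1)] by simp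
  qed
  show ?thesis
    unfolding pre_braided_object_def n
    using V neg_Hom(1)[OF \<sigma>] br on_strands_Hom[OF V \<sigma>, of 1 3] on_strands_Hom[OF V \<sigma>, of 2 3]
    by (simp add: nnn)
qed

section \<open>Quantum co-shuffles of one strand\<close>

lemma T_word:
  assumes V: "V \<in> Obj C" and \<beta>: "\<beta> \<in> Hom C (V \<otimes>\<^sub>o V) (V \<otimes>\<^sub>o V)"
    and w: "shortest_word n s = map h [0..<k]" "\<And>i. i < k \<Longrightarrow> h i \<in> {1..<n}"
  shows "T C V \<beta> n s = prefix_prod (end_ring C (tpow C V n)) (\<lambda>i. on_strands C V n \<beta> (h i)) k"
proof -
  interpret R: ring "end_ring C (tpow C V n)" using V by (intro ring_end_ring) simp
  let ?P = "prefix_prod (end_ring C (tpow C V n)) (\<lambda>i. on_strands C V n \<beta> (h i))"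
  have c: "on_strands C V n \<beta> (h i) \<in> Hom C (tpow C V n) (tpow C V n)" if "i < k" for i
    using w(2)[OF that] by (intro on_strands_Hom[OF V \<beta>]) auto
  have P: "?P j \<in> Hom C (tpow C V n) (tpow C V n)" if "j \<le> k" for j
    using R.prefix_prod_closed[of j "\<lambda>i. on_strands C V n \<beta> (h i)"] c that
    by (simp add: end_ring_simps)
  have "foldr (\<lambda>i f. on_strands C V n \<beta> i \<cdot> f) (map h [0..<j]) x = ?P j \<cdot> x"
    if "j \<le> k" "x \<in> Hom C (tpow C V n) (tpow C V n)" for j x
    using that
  proof (induction j arbitrary: x)
    case 0
    then show ?case using V by (simp add: end_ring_simps Hom_iff)
  next
    case (Suc j)
    have "on_strands C V n \<beta> (h j) \<cdot> x \<in> Hom C (tpow C V n) (tpow C V n)"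
      using Comp_Hom[OF Suc.prems(2) c[of j]] Suc.prems(1) by simp
    then show ?case
      using Suc c[of j] P[of j] Comp_assoc[OF Suc.prems(2) c[of j] P[of j]]
      by (simp add: end_ring_simps)
  qed
  from this[of k "Id C (tpow C V n)"] show ?thesis
    using V P[of k] unfolding T_def w(1) by (simp add: Hom_iff)
qed

lemma finprod_prefix_prod:
  assumes X: "X \<in> Obj C" and b: "\<And>i. i < k \<Longrightarrow> b i \<in> Hom C X X"
  shows "finprod (hom_group C X X) (prefix_prod (end_ring C X) b) {..k} =
    prefix_sum (end_ring C X) b k"
  using b
proof (induction k)
  case 0
  interpret G: comm_group "hom_group C X X" using hom_comm_group[OF X X] .
  show ?case using X Id_Hom[OF X] Plus_Zero[OF Id_Hom[OF X]] by (simp add: hom_group_simps end_ring_simps)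
next
  case (Suc k)
  interpret G: comm_group "hom_group C X X" using hom_comm_group[OF X X] .
  interpret R: ring "end_ring C X" using X by (rule ring_end_ring)
  have c: "prefix_prod (end_ring C X) b j \<in> Hom C X X" if "j \<le> Suc k" for j
    using R.prefix_prod_closed[of j b] Suc.prems that by (simp add: end_ring_simps)
  have d: "prefix_sum (end_ring C X) b k \<in> Hom C X X"
    using R.prefix_sum_closed[of k b] Suc.prems by (simp add: end_ring_simps)
  have "finprod (hom_group C X X) (prefix_prod (end_ring C X) b) {..Suc k} =
      Plus C (prefix_prod (end_ring C X) b (Suc k)) (prefix_sum (end_ring C X) b k)"
    using Suc c by (subst G.finprod_Suc) (auto simp: hom_group_simps simp del: prefix_prod.simps)
  also have "\<dots> = prefix_sum (end_ring C X) b (Suc k)"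
    using G.m_comm[of "prefix_prod (end_ring C X) b (Suc k)" "prefix_sum (end_ring C X) b k"] c[of "Suc k"] d
    by (simp add: hom_group_simps end_ring_simps del: prefix_prod.simps)
  finally show ?case .
qed

text \<open>Covers both kinds of co-shuffles: the sequence \<open>h\<close> lists the crossings, and the shuffles
  correspond to its initial segments.\<close>

lemma csh_by_words:
  assumes V: "V \<in> Obj C" and \<beta>: "\<beta> \<in> Hom C (V \<otimes>\<^sub>o V) (V \<otimes>\<^sub>o V)" and n: "p + q = Suc k"
    and bij: "bij_betw (\<lambda>j. Hilbert_Choice.inv (word_perm (map h [0..<j]))) {..k} (Sh p q)"
    and word: "\<And>j. j \<le> k \<Longrightarrow> shortest_word (Suc k) (word_perm (map h [0..<j])) = map h [0..<j]"
    and h: "\<And>i. i < k \<Longrightarrow> h i \<in> {1..<Suc k}"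
  shows "csh C V \<beta> p q =
    prefix_sum (end_ring C (tpow C V (Suc k))) (\<lambda>i. on_strands C V (Suc k) \<beta> (h i)) k"
proof -
  let ?X = "tpow C V (Suc k)"
  let ?b = "\<lambda>i. on_strands C V (Suc k) \<beta> (h i)"
  let ?s = "\<lambda>j. Hilbert_Choice.inv (word_perm (map h [0..<j]))"
  let ?P = "prefix_prod (end_ring C ?X) ?b"
  have X: "?X \<in> Obj C" using V by (rule tpow_Obj)
  interpret G: comm_group "hom_group C ?X ?X" using hom_comm_group[OF X X] .
  interpret R: ring "end_ring C ?X" using X by (rule ring_end_ring)
  have b: "?b i \<in> Hom C ?X ?X" if "i < k" for i
    using h[OF that] by (intro on_strands_Hom[OF V \<beta>]) auto
  have P: "?P j \<in> Hom C ?X ?X" if "j \<le> k" for j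
    using R.prefix_prod_closed[of j ?b] b that by (simp add: end_ring_simps del: tpow.simps)
  have T: "T C V \<beta> (Suc k) (Hilbert_Choice.inv (?s j)) = ?P j" if "j \<le> k" for j
  proof -
    have "word_perm (map h [0..<j]) permutes {1..Suc k}"
      using h that by (intro word_perm_permutes) auto
    then have "Hilbert_Choice.inv (?s j) = word_perm (map h [0..<j])"
      by (intro inv_inv_eq permutes_bij)
    then show ?thesis using T_word[OF V \<beta> word[OF that]] h that by simp
  qed
  have "csh C V \<beta> p q = finprod (hom_group C ?X ?X)
      (\<lambda>s. T C V \<beta> (Suc k) (Hilbert_Choice.inv s)) (?s ` {..k})"
    unfolding csh_def tpow_add[OF V] n using bij by (simp add: bij_betw_def)
  also have "\<dots> = finprod (hom_group C ?X ?X) (\<lambda>j. T C V \<beta> (Suc k) (Hilbert_Choice.inv (?s j))) {..k}"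
  proof (rule G.finprod_reindex)
    show "(\<lambda>s. T C V \<beta> (Suc k) (Hilbert_Choice.inv s)) \<in> ?s ` {..k} \<rightarrow> carrier (hom_group C ?X ?X)"
      using P T by (auto simp: hom_group_simps simp del: tpow.simps)
  qed (use bij in \<open>simp add: bij_betw_def\<close>)
  also have "\<dots> = finprod (hom_group C ?X ?X) ?P {..k}"
    using P T by (intro G.finprod_cong') (auto simp: hom_group_simps)
  also have "\<dots> = prefix_sum (end_ring C ?X) ?b k"
    using X b by (rule finprod_prefix_prod)
  finally show ?thesis .
qed

lemma csh_first_strand_eq:
  assumes V: "V \<in> Obj C" and \<beta>: "\<beta> \<in> Hom C (V \<otimes>\<^sub>o V) (V \<otimes>\<^sub>o V)"
  shows "csh C V \<beta> 1 q =
    prefix_sum (end_ring C (tpow C V (Suc q))) (\<lambda>i. on_strands C V (Suc q) \<beta> (Suc i)) q"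
  by (rule csh_by_words[OF V \<beta> _ bij_betw_Sh_ascending shortest_word_ascending]) auto

lemma csh_last_strand_eq:
  assumes V: "V \<in> Obj C" and \<beta>: "\<beta> \<in> Hom C (V \<otimes>\<^sub>o V) (V \<otimes>\<^sub>o V)"
  shows "csh C V \<beta> p 1 =
    prefix_sum (end_ring C (tpow C V (Suc p))) (\<lambda>i. on_strands C V (Suc p) \<beta> (p - i)) p"
  by (rule csh_by_words[OF V \<beta> _ bij_betw_Sh_descending shortest_word_descending]) auto

lemma csh_Hom:
  assumes V: "V \<in> Obj C" and \<beta>: "\<beta> \<in> Hom C (V \<otimes>\<^sub>o V) (V \<otimes>\<^sub>o V)"
  shows "csh C V \<beta> 1 n \<in> Hom C (tpow C V (Suc n)) (tpow C V (Suc n))"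
    and "csh C V \<beta> n 1 \<in> Hom C (tpow C V (Suc n)) (tpow C V (Suc n))"
proof -
  interpret R: ring "end_ring C (tpow C V (Suc n))" using V by (intro ring_end_ring tpow_Obj)
  show "csh C V \<beta> 1 n \<in> Hom C (tpow C V (Suc n)) (tpow C V (Suc n))"
    unfolding csh_first_strand_eq[OF V \<beta>] end_ring_simps(1)[symmetric]
    by (rule R.prefix_sum_closed, unfold end_ring_simps(1), rule on_strands_Hom[OF V \<beta>]) auto
  show "csh C V \<beta> n 1 \<in> Hom C (tpow C V (Suc n)) (tpow C V (Suc n))"
    unfolding csh_last_strand_eq[OF V \<beta>] end_ring_simps(1)[symmetric]
    by (rule R.prefix_sum_closed, unfold end_ring_simps(1), rule on_strands_Hom[OF V \<beta>]) auto
qed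

text \<open>Adding a strand is a homomorphism between endomorphism rings, so that it can be applied crossing
  by crossing.\<close>

lemma whisker_prefix_sum:
  assumes V: "V \<in> Obj C" and \<beta>: "\<beta> \<in> Hom C (V \<otimes>\<^sub>o V) (V \<otimes>\<^sub>o V)"
    and h: "\<And>i. i < k \<Longrightarrow> h i \<in> {1..<n}"
  shows "Id C V \<otimes>\<^sub>a prefix_sum (end_ring C (tpow C V n)) (\<lambda>i. on_strands C V n \<beta> (h i)) k =
      prefix_sum (end_ring C (tpow C V (Suc n))) (\<lambda>i. on_strands C V (Suc n) \<beta> (Suc (h i))) k"
    and "prefix_sum (end_ring C (tpow C V n)) (\<lambda>i. on_strands C V n \<beta> (h i)) k \<otimes>\<^sub>a Id C V =
      prefix_sum (end_ring C (tpow C V (Suc n))) (\<lambda>i. on_strands C V (Suc n) \<beta> (h i)) k"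
proof -
  have X: "tpow C V n \<in> Obj C" "tpow C V (Suc n) \<in> Obj C" using V by (auto simp del: tpow.simps)
  have eq: "V \<otimes>\<^sub>o tpow C V n = tpow C V (Suc n)" "tpow C V n \<otimes>\<^sub>o V = tpow C V (Suc n)"
    using V by (simp_all add: tpow_snoc)
  have c: "on_strands C V n \<beta> (h i) \<in> Hom C (tpow C V n) (tpow C V n)" if "i < k" for i
    using h[OF that] by (intro on_strands_Hom[OF V \<beta>]) auto
  have l: "Id C V \<otimes>\<^sub>a on_strands C V n \<beta> (h i) = on_strands C V (Suc n) \<beta> (Suc (h i))" if "i < k" for i
    using on_strands_whisker[OF V \<beta>, of "h i" n 1 0] h[OF that] c[OF that] V
    by (simp add: TensorA_Unit_right Hom_iff)
  have r: "on_strands C V n \<beta> (h i) \<otimes>\<^sub>a Id C V = on_strands C V (Suc n) \<beta> (h i)" if "i < k" for i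
    using on_strands_whisker[OF V \<beta>, of "h i" n 0 1] h[OF that] c[OF that] V
    by (simp add: TensorA_Unit_left Hom_iff)
  have "Id C V \<otimes>\<^sub>a prefix_sum (end_ring C (tpow C V n)) (\<lambda>i. on_strands C V n \<beta> (h i)) k =
      prefix_sum (end_ring C (tpow C V (Suc n))) (\<lambda>i. Id C V \<otimes>\<^sub>a on_strands C V n \<beta> (h i)) k"
    by (rule ring_hom_prefix_sum[OF ring_end_ring[OF X(1)] ring_end_ring[OF X(2)]
          whisker_left_hom[OF X(1) V, unfolded eq]]) (simp add: end_ring_simps c)
  also have "\<dots> = prefix_sum (end_ring C (tpow C V (Suc n))) (\<lambda>i. on_strands C V (Suc n) \<beta> (Suc (h i))) k"
    by (rule prefix_sum_cong) (rule l)
  finally show "Id C V \<otimes>\<^sub>a prefix_sum (end_ring C (tpow C V n)) (\<lambda>i. on_strands C V n \<beta> (h i)) k =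
      prefix_sum (end_ring C (tpow C V (Suc n))) (\<lambda>i. on_strands C V (Suc n) \<beta> (Suc (h i))) k" .
  have "prefix_sum (end_ring C (tpow C V n)) (\<lambda>i. on_strands C V n \<beta> (h i)) k \<otimes>\<^sub>a Id C V =
      prefix_sum (end_ring C (tpow C V (Suc n))) (\<lambda>i. on_strands C V n \<beta> (h i) \<otimes>\<^sub>a Id C V) k"
    by (rule ring_hom_prefix_sum[OF ring_end_ring[OF X(1)] ring_end_ring[OF X(2)]
          whisker_right_hom[OF X(1) V, unfolded eq]]) (simp add: end_ring_simps c)
  also have "\<dots> = prefix_sum (end_ring C (tpow C V (Suc n))) (\<lambda>i. on_strands C V (Suc n) \<beta> (h i)) k"
    by (rule prefix_sum_cong) (rule r)
  finally show "prefix_sum (end_ring C (tpow C V n)) (\<lambda>i. on_strands C V n \<beta> (h i)) k \<otimes>\<^sub>a Id C V =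
      prefix_sum (end_ring C (tpow C V (Suc n))) (\<lambda>i. on_strands C V (Suc n) \<beta> (h i)) k" .
qed

text \<open>The co-shuffles and their whiskerings are prefix sums of one braid family \<open>b\<close> on
  \<open>k + 2\<close> strands or of its reversal, so these are the ring identities of the first part.\<close>

lemma csh_identities:
  assumes pb: "pre_braided_object C V \<beta>"
  shows csh_first_strand_factor: "\<exists>y \<in> Hom C (tpow C V (k + 2)) (tpow C V (k + 2)).
      (Id C V \<otimes>\<^sub>a csh C V \<beta> 1 k) \<cdot> csh C V \<beta> 1 (Suc k) =
      Plus C (Id C (tpow C V (k + 2))) (\<beta> \<otimes>\<^sub>a Id C (tpow C V k)) \<cdot> y"
    and csh_last_strand_factor: "\<exists>y \<in> Hom C (tpow C V (k + 2)) (tpow C V (k + 2)).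
      (csh C V \<beta> k 1 \<otimes>\<^sub>a Id C V) \<cdot> csh C V \<beta> (Suc k) 1 =
      Plus C (Id C (tpow C V (k + 2))) (Id C (tpow C V k) \<otimes>\<^sub>a \<beta>) \<cdot> y"
    and csh_coassoc: "(csh C V \<beta> 1 k \<otimes>\<^sub>a Id C V) \<cdot> csh C V \<beta> (Suc k) 1 =
      (Id C V \<otimes>\<^sub>a csh C V \<beta> k 1) \<cdot> csh C V \<beta> 1 (Suc k)"
proof -
  have V: "V \<in> Obj C" and \<beta>: "\<beta> \<in> Hom C (V \<otimes>\<^sub>o V) (V \<otimes>\<^sub>o V)"
    using pb by (auto simp: pre_braided_object_def)
  then have \<beta>A: "\<beta> \<in> Arr C" by (simp add: Hom_iff)
  let ?X = "tpow C V (Suc (Suc k))"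
  let ?R = "end_ring C ?X"
  define b where "b = (\<lambda>i. on_strands C V (Suc (Suc k)) \<beta> (Suc i))"
  interpret R: ring ?R using V by (intro ring_end_ring tpow_Obj)
  have br: "braid_family ?R b (Suc k)"
    unfolding b_def by (rule braid_family_on_strands[OF pb])
  \<comment> \<open>A co-shuffle next to an idle strand omits the first or the last crossing of \<open>b\<close>.\<close>
  have l: "csh C V \<beta> 1 (Suc k) = prefix_sum ?R b (Suc k)"
    unfolding csh_first_strand_eq[OF V \<beta>] b_def ..
  have r: "csh C V \<beta> (Suc k) 1 = prefix_sum ?R (\<lambda>i. b (k - i)) (Suc k)"
    unfolding csh_last_strand_eq[OF V \<beta>] b_def by (rule prefix_sum_cong) (simp add: Suc_diff_le)
  have Vl: "Id C V \<otimes>\<^sub>a csh C V \<beta> 1 k = prefix_sum ?R (\<lambda>i. b (Suc i)) k"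
    unfolding csh_first_strand_eq[OF V \<beta>] b_def by (rule whisker_prefix_sum(1)[OF V \<beta>]) simp
  have lV: "csh C V \<beta> 1 k \<otimes>\<^sub>a Id C V = prefix_sum ?R b k"
    unfolding csh_first_strand_eq[OF V \<beta>] b_def by (rule whisker_prefix_sum(2)[OF V \<beta>]) simp
  have Vr: "Id C V \<otimes>\<^sub>a csh C V \<beta> k 1 = prefix_sum ?R (\<lambda>i. b (k - i)) k"
    unfolding csh_last_strand_eq[OF V \<beta>] b_def by (rule whisker_prefix_sum(1)[OF V \<beta>]) auto
  have "csh C V \<beta> k 1 \<otimes>\<^sub>a Id C V =
      prefix_sum ?R (\<lambda>i. on_strands C V (Suc (Suc k)) \<beta> (k - i)) k"
    unfolding csh_last_strand_eq[OF V \<beta>] by (rule whisker_prefix_sum(2)[OF V \<beta>]) auto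
  also have "\<dots> = prefix_sum ?R (\<lambda>i. b (k - Suc i)) k"
    unfolding b_def by (rule prefix_sum_cong) (simp add: Suc_diff_Suc)
  finally have rV: "csh C V \<beta> k 1 \<otimes>\<^sub>a Id C V = prefix_sum ?R (\<lambda>i. b (k - Suc i)) k" .
  have b0: "b 0 = \<beta> \<otimes>\<^sub>a Id C (tpow C V k)"
    unfolding b_def on_strands_def using V \<beta>A by (simp add: TensorA_Unit_left)
  have bk: "b k = Id C (tpow C V k) \<otimes>\<^sub>a \<beta>"
    unfolding b_def on_strands_def using V \<beta>A by (simp add: TensorA_Unit_right)
  show "\<exists>y \<in> Hom C (tpow C V (k + 2)) (tpow C V (k + 2)).
      (Id C V \<otimes>\<^sub>a csh C V \<beta> 1 k) \<cdot> csh C V \<beta> 1 (Suc k) =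
      Plus C (Id C (tpow C V (k + 2))) (\<beta> \<otimes>\<^sub>a Id C (tpow C V k)) \<cdot> y"
    using R.prefix_sum_factor[OF br] unfolding l Vl b0 end_ring_simps by simp
  show "\<exists>y \<in> Hom C (tpow C V (k + 2)) (tpow C V (k + 2)).
      (csh C V \<beta> k 1 \<otimes>\<^sub>a Id C V) \<cdot> csh C V \<beta> (Suc k) 1 =
      Plus C (Id C (tpow C V (k + 2))) (Id C (tpow C V k) \<otimes>\<^sub>a \<beta>) \<cdot> y"
    using R.prefix_sum_factor[OF braid_family_rev[OF br]] unfolding r rV bk end_ring_simps
    by (simp add: bk)
  show "(csh C V \<beta> 1 k \<otimes>\<^sub>a Id C V) \<cdot> csh C V \<beta> (Suc k) 1 =
      (Id C V \<otimes>\<^sub>a csh C V \<beta> k 1) \<cdot> csh C V \<beta> 1 (Suc k)"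
    using R.prefix_sum_coassoc[OF br] unfolding l r lV Vr end_ring_simps .
qed

end

section \<open>Strands acting on a bimodule\<close>

text \<open>The left action \<open>\<mu>\<close> turned into an action of the last strand on \<open>M\<close> from the right,
  the strand being brought to \<open>M\<close> by the symmetry. The family \<open>d\<^sup>\<lambda>\<close> is, up to sign,
  this map after a co-shuffle, just as \<open>\<^sup>\<rho>d\<close> is the action of the first strand after a
  co-shuffle.\<close>

definition last_action :: "('o, 'a, 'x) moncat_scheme \<Rightarrow> 'o \<Rightarrow> 'o \<Rightarrow> 'a \<Rightarrow> 'o \<Rightarrow> 'a" where
  "last_action C V M \<mu> W =
     Braid C W M \<cdot>\<^bsub>C\<^esub> (Id C W \<otimes>\<^sub>a\<^bsub>C\<^esub> \<mu>) \<cdot>\<^bsub>C\<^esub> Braid C M (W \<otimes>\<^sub>o\<^bsub>C\<^esub> V)"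

context symmetric_preadditive_strict_monoidal_category
begin

lemma inverse_arr_Braid:
  assumes X: "X \<in> Obj C" and Y: "Y \<in> Obj C"
  shows "inverse_arr C (Braid C X Y) = Braid C Y X"
  unfolding inverse_arr_def
proof (rule the_equality)
  show "Braid C Y X \<in> Hom C (Cod C (Braid C X Y)) (Dom C (Braid C X Y)) \<and>
      Braid C Y X \<cdot> Braid C X Y = Id C (Dom C (Braid C X Y)) \<and>
      Braid C X Y \<cdot> Braid C Y X = Id C (Cod C (Braid C X Y))"
    using X Y Braid_symmetric by (auto simp: Hom_iff)
next
  fix g
  assume g: "g \<in> Hom C (Cod C (Braid C X Y)) (Dom C (Braid C X Y)) \<and>
      g \<cdot> Braid C X Y = Id C (Dom C (Braid C X Y)) \<and>
      Braid C X Y \<cdot> g = Id C (Cod C (Braid C X Y))"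
  then have "(g \<cdot> Braid C X Y) \<cdot> Braid C Y X = g \<cdot> (Braid C X Y \<cdot> Braid C Y X)"
    using X Y by (intro comp_assoc) (auto simp: Hom_iff)
  then show "g = Braid C Y X"
    using g X Y Braid_symmetric[OF Y X] by (simp add: Hom_iff)
qed

lemma last_action_Hom:
  assumes "V \<in> Obj C" "M \<in> Obj C" "W \<in> Obj C" "\<mu> \<in> Hom C (V \<otimes>\<^sub>o M) M"
  shows "last_action C V M \<mu> W \<in> Hom C (M \<otimes>\<^sub>o W \<otimes>\<^sub>o V) (M \<otimes>\<^sub>o W)"
  using assms by (simp add: last_action_def Hom_iff)

text \<open>Instead of moving \<open>M\<close> past all strands, letting \<open>\<mu>\<close> act and moving \<open>M\<close> back, one may
  carry the last strand to \<open>M\<close>: by naturality the two passages of \<open>M\<close> across \<open>W\<close> cancel.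
  In this form the last action is compatible with whatever happens on \<open>W\<close>.\<close>

lemma last_action_eq:
  assumes o: "V \<in> Obj C" "M \<in> Obj C" "W \<in> Obj C" and \<mu>: "\<mu> \<in> Hom C (V \<otimes>\<^sub>o M) M"
  shows "last_action C V M \<mu> W = ((\<mu> \<cdot> Braid C M V) \<otimes>\<^sub>a Id C W) \<cdot> (Id C M \<otimes>\<^sub>a Braid C W V)"
proof -
  define \<nu> where "\<nu> = \<mu> \<cdot> Braid C M V"
  have mu: "\<mu> \<in> Arr C" "Dom C \<mu> = V \<otimes>\<^sub>o M" "Cod C \<mu> = M" using \<mu> by (auto simp: Hom_iff)
  have \<nu>: "\<nu> \<in> Hom C (M \<otimes>\<^sub>o V) M" using o mu by (simp add: \<nu>_def Hom_iff)
  then have nu: "\<nu> \<in> Arr C" "Dom C \<nu> = M \<otimes>\<^sub>o V" "Cod C \<nu> = M" by (auto simp: Hom_iff)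
  have "(Id C W \<otimes>\<^sub>a \<mu>) \<cdot> Braid C M (W \<otimes>\<^sub>o V) = (Id C W \<otimes>\<^sub>a \<nu>) \<cdot> (Braid C M W \<otimes>\<^sub>a Id C V)"
    unfolding Braid_TensorO_right[OF o(2,3,1)]
    by (subst comp_assoc[symmetric]) (use o mu in \<open>simp_all add: interchange \<nu>_def\<close>)
  then have "last_action C V M \<mu> W =
      (Braid C W M \<cdot> (Id C W \<otimes>\<^sub>a \<nu>)) \<cdot> (Braid C M W \<otimes>\<^sub>a Id C V)"
    unfolding last_action_def using o nu by (simp add: comp_assoc)
  also have "Braid C W M \<cdot> (Id C W \<otimes>\<^sub>a \<nu>) = (\<nu> \<otimes>\<^sub>a Id C W) \<cdot> Braid C W (M \<otimes>\<^sub>o V)"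
    by (rule Braid_natural[OF Id_Hom[OF o(3)] \<nu>])
  also have "((\<nu> \<otimes>\<^sub>a Id C W) \<cdot> Braid C W (M \<otimes>\<^sub>o V)) \<cdot> (Braid C M W \<otimes>\<^sub>a Id C V) =
      (\<nu> \<otimes>\<^sub>a Id C W) \<cdot> (Id C M \<otimes>\<^sub>a Braid C W V) \<cdot> (Braid C W M \<otimes>\<^sub>a Id C V) \<cdot> (Braid C M W \<otimes>\<^sub>a Id C V)"
    unfolding Braid_TensorO_right[OF o(3,2,1)] using o nu by (simp add: comp_assoc)
  also have "(Braid C W M \<otimes>\<^sub>a Id C V) \<cdot> (Braid C M W \<otimes>\<^sub>a Id C V) = Id C (M \<otimes>\<^sub>o W \<otimes>\<^sub>o V)"
    using o Braid_symmetric[OF o(2,3)] by (simp add: interchange TensorA_Id)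
  finally show ?thesis using o by (simp add: \<nu>_def)
qed

lemma last_action_slide:
  assumes o: "V \<in> Obj C" "M \<in> Obj C" "W \<in> Obj C" and \<mu>: "\<mu> \<in> Hom C (V \<otimes>\<^sub>o M) M"
    and f: "f \<in> Hom C W W"
  shows "(Id C M \<otimes>\<^sub>a f) \<cdot> last_action C V M \<mu> W =
    last_action C V M \<mu> W \<cdot> (Id C M \<otimes>\<^sub>a f \<otimes>\<^sub>a Id C V)"
proof -
  define \<nu> where "\<nu> = \<mu> \<cdot> Braid C M V"
  have \<nu>: "\<nu> \<in> Hom C (M \<otimes>\<^sub>o V) M" using o \<mu> by (simp add: \<nu>_def Hom_iff)
  then have nu: "\<nu> \<in> Arr C" "Dom C \<nu> = M \<otimes>\<^sub>o V" "Cod C \<nu> = M" by (auto simp: Hom_iff)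
  have fA: "f \<in> Arr C" "Dom C f = W" "Cod C f = W" using f by (auto simp: Hom_iff)
  have "(Id C M \<otimes>\<^sub>a f) \<cdot> last_action C V M \<mu> W =
      ((Id C M \<otimes>\<^sub>a f) \<cdot> (\<nu> \<otimes>\<^sub>a Id C W)) \<cdot> (Id C M \<otimes>\<^sub>a Braid C W V)"
    unfolding last_action_eq[OF o \<mu>] \<nu>_def[symmetric] using o nu fA by (simp add: comp_assoc)
  also have "(Id C M \<otimes>\<^sub>a f) \<cdot> (\<nu> \<otimes>\<^sub>a Id C W) = (\<nu> \<otimes>\<^sub>a Id C W) \<cdot> (Id C M \<otimes>\<^sub>a Id C V \<otimes>\<^sub>a f)"
    using slide[OF \<nu> f] o fA by (simp add: TensorA_Id[symmetric] TensorA_assoc)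
  also have "((\<nu> \<otimes>\<^sub>a Id C W) \<cdot> (Id C M \<otimes>\<^sub>a Id C V \<otimes>\<^sub>a f)) \<cdot> (Id C M \<otimes>\<^sub>a Braid C W V) =
      (\<nu> \<otimes>\<^sub>a Id C W) \<cdot> (Id C M \<otimes>\<^sub>a ((Id C V \<otimes>\<^sub>a f) \<cdot> Braid C W V))"
    using o nu fA by (simp add: comp_assoc interchange)
  also have "(Id C V \<otimes>\<^sub>a f) \<cdot> Braid C W V = Braid C W V \<cdot> (f \<otimes>\<^sub>a Id C V)"
    using Braid_natural[OF f Id_Hom[OF o(1)]] by simp
  also have "(\<nu> \<otimes>\<^sub>a Id C W) \<cdot> (Id C M \<otimes>\<^sub>a (Braid C W V \<cdot> (f \<otimes>\<^sub>a Id C V))) =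
      last_action C V M \<mu> W \<cdot> (Id C M \<otimes>\<^sub>a f \<otimes>\<^sub>a Id C V)"
    unfolding last_action_eq[OF o \<mu>] \<nu>_def[symmetric] using o nu fA by (simp add: comp_assoc interchange)
  finally show ?thesis .
qed

text \<open>Two strands act, the first through \<open>\<rho>\<close> and the last through \<open>\<nu> = \<mu> \<circ> c\<close>.
  The compatibility of the two actions on \<open>V \<otimes> M \<otimes> V\<close> becomes, after moving the left
  \<open>V\<close> across, the statement (\<open>key\<close>) that \<open>\<rho>\<close> and \<open>\<nu>\<close> commute up to the symmetry
  of \<open>V \<otimes> V\<close>, which is the crossing that the last strand makes with the first one.\<close>

lemma first_last_action_commute:
  assumes bim: "bimodule C V \<sigma> M \<rho> \<mu>" and V: "V \<in> Obj C" and W: "W \<in> Obj C"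
  shows "(\<rho> \<otimes>\<^sub>a Id C W) \<cdot> last_action C V M \<mu> (V \<otimes>\<^sub>o W) =
    last_action C V M \<mu> W \<cdot> (\<rho> \<otimes>\<^sub>a Id C (W \<otimes>\<^sub>o V))"
proof -
  have M: "M \<in> Obj C" and \<rho>: "\<rho> \<in> Hom C (M \<otimes>\<^sub>o V) M" and \<mu>: "\<mu> \<in> Hom C (V \<otimes>\<^sub>o M) M"
    and comm: "\<rho> \<cdot> (\<mu> \<otimes>\<^sub>a Id C V) = \<mu> \<cdot> (Id C V \<otimes>\<^sub>a \<rho>)"
    using bim by (auto simp: bimodule_def)
  define \<nu> where "\<nu> = \<mu> \<cdot> Braid C M V"
  have mu: "\<mu> \<in> Arr C" "Dom C \<mu> = V \<otimes>\<^sub>o M" "Cod C \<mu> = M" using \<mu> by (auto simp: Hom_iff)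
  have rho: "\<rho> \<in> Arr C" "Dom C \<rho> = M \<otimes>\<^sub>o V" "Cod C \<rho> = M" using \<rho> by (auto simp: Hom_iff)
  have \<nu>: "\<nu> \<in> Hom C (M \<otimes>\<^sub>o V) M" using V M mu by (simp add: \<nu>_def Hom_iff)
  then have nu: "\<nu> \<in> Arr C" "Dom C \<nu> = M \<otimes>\<^sub>o V" "Cod C \<nu> = M" by (auto simp: Hom_iff)
  have key: "\<rho> \<cdot> (\<nu> \<otimes>\<^sub>a Id C V) \<cdot> (Id C M \<otimes>\<^sub>a Braid C V V) = \<nu> \<cdot> (\<rho> \<otimes>\<^sub>a Id C V)"
  proof -
    have "\<nu> \<cdot> (\<rho> \<otimes>\<^sub>a Id C V) = \<mu> \<cdot> (Braid C M V \<cdot> (\<rho> \<otimes>\<^sub>a Id C V))"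
      unfolding \<nu>_def using V M mu rho by (simp add: comp_assoc)
    also have "Braid C M V \<cdot> (\<rho> \<otimes>\<^sub>a Id C V) = (Id C V \<otimes>\<^sub>a \<rho>) \<cdot> Braid C (M \<otimes>\<^sub>o V) V"
      by (rule Braid_natural[OF \<rho> Id_Hom[OF V]])
    also have "\<mu> \<cdot> (Id C V \<otimes>\<^sub>a \<rho>) \<cdot> Braid C (M \<otimes>\<^sub>o V) V = (\<mu> \<cdot> (Id C V \<otimes>\<^sub>a \<rho>)) \<cdot> Braid C (M \<otimes>\<^sub>o V) V"
      using V M mu rho by (simp add: comp_assoc)
    also have "\<dots> = \<rho> \<cdot> ((\<mu> \<otimes>\<^sub>a Id C V) \<cdot> (Braid C M V \<otimes>\<^sub>a Id C V)) \<cdot> (Id C M \<otimes>\<^sub>a Braid C V V)"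
      unfolding comm[symmetric] Braid_TensorO_left[OF M V V] using V M mu rho by (simp add: comp_assoc)
    also have "(\<mu> \<otimes>\<^sub>a Id C V) \<cdot> (Braid C M V \<otimes>\<^sub>a Id C V) = \<nu> \<otimes>\<^sub>a Id C V"
      using V M mu by (simp add: interchange \<nu>_def)
    finally show ?thesis ..
  qed
  have "(\<rho> \<otimes>\<^sub>a Id C W) \<cdot> last_action C V M \<mu> (V \<otimes>\<^sub>o W) =
      (\<rho> \<otimes>\<^sub>a Id C W) \<cdot> ((\<nu> \<otimes>\<^sub>a Id C V) \<otimes>\<^sub>a Id C W) \<cdot>
      ((Id C M \<otimes>\<^sub>a Braid C V V) \<otimes>\<^sub>a Id C W) \<cdot> (Id C M \<otimes>\<^sub>a Id C V \<otimes>\<^sub>a Braid C W V)"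
    unfolding last_action_eq[OF V M TensorO_Obj[OF V W] \<mu>] \<nu>_def[symmetric]
      Braid_TensorO_left[OF V W V]
    using V M W nu by (simp add: TensorA_Id[symmetric] TensorA_assoc interchange)
  also have "\<dots> = ((\<rho> \<cdot> (\<nu> \<otimes>\<^sub>a Id C V) \<cdot> (Id C M \<otimes>\<^sub>a Braid C V V)) \<otimes>\<^sub>a Id C W) \<cdot>
      (Id C M \<otimes>\<^sub>a Id C V \<otimes>\<^sub>a Braid C W V)"
    using V M W nu rho by (simp add: comp_assoc[symmetric] interchange)
  also have "\<dots> = (\<nu> \<otimes>\<^sub>a Id C W) \<cdot>
      (((\<rho> \<otimes>\<^sub>a Id C V) \<otimes>\<^sub>a Id C W) \<cdot> (Id C M \<otimes>\<^sub>a Id C V \<otimes>\<^sub>a Braid C W V))"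
    unfolding key using V M W nu rho by (simp add: comp_assoc[symmetric] interchange)
  also have "((\<rho> \<otimes>\<^sub>a Id C V) \<otimes>\<^sub>a Id C W) \<cdot> (Id C M \<otimes>\<^sub>a Id C V \<otimes>\<^sub>a Braid C W V) =
      (Id C M \<otimes>\<^sub>a Braid C W V) \<cdot> (\<rho> \<otimes>\<^sub>a Id C (W \<otimes>\<^sub>o V))"
    using slide[OF \<rho> Braid_Hom[OF W V]] V M W rho
    by (simp add: TensorA_assoc TensorA_Id[symmetric])
  finally show ?thesis
    unfolding last_action_eq[OF V M W \<mu>] \<nu>_def[symmetric] using V M W nu rho by (simp add: comp_assoc)
qed

text \<open>The module axiom says that two consecutive actions absorb \<open>\<sigma>\<close>, that is, that they
  vanish after \<open>1 - \<sigma>\<close>, the factor which the co-shuffles for \<open>-\<sigma>\<close> provide.\<close>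

lemma right_action_one_minus_braiding:
  assumes bim: "bimodule C V \<sigma> M \<rho> \<mu>" and V: "V \<in> Obj C" and \<sigma>: "\<sigma> \<in> Hom C (V \<otimes>\<^sub>o V) (V \<otimes>\<^sub>o V)"
  shows "\<rho> \<cdot> (\<rho> \<otimes>\<^sub>a Id C V) \<cdot> (Id C M \<otimes>\<^sub>a Plus C (Id C (V \<otimes>\<^sub>o V)) (neg C \<sigma>)) =
    Zero C (M \<otimes>\<^sub>o V \<otimes>\<^sub>o V) M"
proof -
  have M: "M \<in> Obj C" and \<rho>: "\<rho> \<in> Hom C (M \<otimes>\<^sub>o V) M"
    and eq: "\<rho> \<cdot> (\<rho> \<otimes>\<^sub>a Id C V) = \<rho> \<cdot> (\<rho> \<otimes>\<^sub>a Id C V) \<cdot> (Id C M \<otimes>\<^sub>a \<sigma>)"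
    using bim by (auto simp: bimodule_def)
  define x where "x = \<rho> \<cdot> (\<rho> \<otimes>\<^sub>a Id C V)"
  have x: "x \<in> Hom C (M \<otimes>\<^sub>o V \<otimes>\<^sub>o V) M"
    using V M \<rho> by (simp add: x_def Hom_iff)
  have VV: "V \<otimes>\<^sub>o V \<in> Obj C" using V by simp
  have s: "Id C M \<otimes>\<^sub>a \<sigma> \<in> Hom C (M \<otimes>\<^sub>o V \<otimes>\<^sub>o V) (M \<otimes>\<^sub>o V \<otimes>\<^sub>o V)"
    using TensorA_Hom[OF Id_Hom[OF M] \<sigma>] .
  have xs: "x \<cdot> (Id C M \<otimes>\<^sub>a \<sigma>) = x"
    unfolding x_def by (subst (2) eq) (use V M \<rho> \<sigma> in \<open>simp add: Hom_iff comp_assoc\<close>)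
  have "\<rho> \<cdot> (\<rho> \<otimes>\<^sub>a Id C V) \<cdot> (Id C M \<otimes>\<^sub>a Plus C (Id C (V \<otimes>\<^sub>o V)) (neg C \<sigma>)) =
      x \<cdot> (Id C M \<otimes>\<^sub>a Plus C (Id C (V \<otimes>\<^sub>o V)) (neg C \<sigma>))"
    unfolding x_def using V M \<rho> \<sigma> by (simp add: Hom_iff comp_assoc)
  also have "x \<cdot> (Id C M \<otimes>\<^sub>a Plus C (Id C (V \<otimes>\<^sub>o V)) (neg C \<sigma>)) =
      x \<cdot> Plus C (Id C (M \<otimes>\<^sub>o V \<otimes>\<^sub>o V)) (neg C (Id C M \<otimes>\<^sub>a \<sigma>))"
    using TensorA_Plus_right[OF Id_Hom[OF M] Id_Hom[OF VV] neg_Hom(1)[OF \<sigma>]]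
      TensorA_neg(1)[OF Id_Hom[OF M] \<sigma>] TensorA_Id[OF M VV] by simp
  also have "\<dots> = Plus C x (neg C x)"
    using Comp_Plus_right[OF Id_Hom neg_Hom(1)[OF s] x] M VV Comp_neg(1)[OF s x] xs x
    by (simp add: Hom_iff)
  also have "\<dots> = Zero C (M \<otimes>\<^sub>o V \<otimes>\<^sub>o V) M" using neg_Hom(2)[OF x] .
  finally show ?thesis .
qed

lemma left_action_one_minus_braiding:
  assumes bim: "bimodule C V \<sigma> M \<rho> \<mu>" and V: "V \<in> Obj C" and \<sigma>: "\<sigma> \<in> Hom C (V \<otimes>\<^sub>o V) (V \<otimes>\<^sub>o V)"
  shows "\<mu> \<cdot> (Id C V \<otimes>\<^sub>a \<mu>) \<cdot> (Plus C (Id C (V \<otimes>\<^sub>o V)) (neg C \<sigma>) \<otimes>\<^sub>a Id C M) =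
    Zero C (V \<otimes>\<^sub>o V \<otimes>\<^sub>o M) M"
proof -
  have M: "M \<in> Obj C" and \<mu>: "\<mu> \<in> Hom C (V \<otimes>\<^sub>o M) M"
    and eq: "\<mu> \<cdot> (Id C V \<otimes>\<^sub>a \<mu>) = \<mu> \<cdot> (Id C V \<otimes>\<^sub>a \<mu>) \<cdot> (\<sigma> \<otimes>\<^sub>a Id C M)"
    using bim by (auto simp: bimodule_def)
  define x where "x = \<mu> \<cdot> (Id C V \<otimes>\<^sub>a \<mu>)"
  have x: "x \<in> Hom C (V \<otimes>\<^sub>o V \<otimes>\<^sub>o M) M"
    using V M \<mu> by (simp add: x_def Hom_iff)
  have VV: "V \<otimes>\<^sub>o V \<in> Obj C" using V by simp
  have s: "\<sigma> \<otimes>\<^sub>a Id C M \<in> Hom C (V \<otimes>\<^sub>o V \<otimes>\<^sub>o M) (V \<otimes>\<^sub>o V \<otimes>\<^sub>o M)"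
    using TensorA_Hom[OF \<sigma> Id_Hom[OF M]] V M by simp
  have xs: "x \<cdot> (\<sigma> \<otimes>\<^sub>a Id C M) = x"
    unfolding x_def by (subst (2) eq) (use V M \<mu> \<sigma> in \<open>simp add: Hom_iff comp_assoc\<close>)
  have "\<mu> \<cdot> (Id C V \<otimes>\<^sub>a \<mu>) \<cdot> (Plus C (Id C (V \<otimes>\<^sub>o V)) (neg C \<sigma>) \<otimes>\<^sub>a Id C M) =
      x \<cdot> (Plus C (Id C (V \<otimes>\<^sub>o V)) (neg C \<sigma>) \<otimes>\<^sub>a Id C M)"
    unfolding x_def using V M \<mu> \<sigma> by (simp add: Hom_iff comp_assoc)
  also have "x \<cdot> (Plus C (Id C (V \<otimes>\<^sub>o V)) (neg C \<sigma>) \<otimes>\<^sub>a Id C M) =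
      x \<cdot> Plus C (Id C (V \<otimes>\<^sub>o V \<otimes>\<^sub>o M)) (neg C (\<sigma> \<otimes>\<^sub>a Id C M))"
    using TensorA_Plus_left[OF Id_Hom[OF VV] neg_Hom(1)[OF \<sigma>] Id_Hom[OF M]]
      TensorA_neg(2)[OF \<sigma> Id_Hom[OF M]] TensorA_Id[OF VV M] V M by simp
  also have "\<dots> = Plus C x (neg C x)"
    using Comp_Plus_right[OF Id_Hom neg_Hom(1)[OF s] x] M V Comp_neg(1)[OF s x] xs x
    by (simp add: Hom_iff)
  also have "\<dots> = Zero C (V \<otimes>\<^sub>o V \<otimes>\<^sub>o M) M" using neg_Hom(2)[OF x] .
  finally show ?thesis .
qed

lemma first_action_twice:
  assumes bim: "bimodule C V \<sigma> M \<rho> \<mu>" and V: "V \<in> Obj C" and \<sigma>: "\<sigma> \<in> Hom C (V \<otimes>\<^sub>o V) (V \<otimes>\<^sub>o V)"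
    and W: "W \<in> Obj C"
  shows "(\<rho> \<otimes>\<^sub>a Id C W) \<cdot> (\<rho> \<otimes>\<^sub>a Id C (V \<otimes>\<^sub>o W)) \<cdot>
      (Id C M \<otimes>\<^sub>a Plus C (Id C (V \<otimes>\<^sub>o V \<otimes>\<^sub>o W)) (neg C \<sigma> \<otimes>\<^sub>a Id C W)) =
    Zero C (M \<otimes>\<^sub>o V \<otimes>\<^sub>o V \<otimes>\<^sub>o W) (M \<otimes>\<^sub>o W)"
proof -
  have M: "M \<in> Obj C" and \<rho>: "\<rho> \<in> Hom C (M \<otimes>\<^sub>o V) M" using bim by (auto simp: bimodule_def)
  let ?k = "Plus C (Id C (V \<otimes>\<^sub>o V)) (neg C \<sigma>)"
  have VV: "V \<otimes>\<^sub>o V \<in> Obj C" using V by simp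
  have "Plus C (Id C (V \<otimes>\<^sub>o V \<otimes>\<^sub>o W)) (neg C \<sigma> \<otimes>\<^sub>a Id C W) = ?k \<otimes>\<^sub>a Id C W"
    using TensorA_Plus_left[OF Id_Hom[OF VV] neg_Hom(1)[OF \<sigma>] Id_Hom[OF W]] TensorA_Id[OF VV W] V W
    by simp
  moreover have "\<rho> \<otimes>\<^sub>a Id C (V \<otimes>\<^sub>o W) = (\<rho> \<otimes>\<^sub>a Id C V) \<otimes>\<^sub>a Id C W"
    using V W \<rho> by (simp add: TensorA_Id[symmetric] TensorA_assoc Hom_iff)
  moreover have "Id C M \<otimes>\<^sub>a ?k \<otimes>\<^sub>a Id C W = (Id C M \<otimes>\<^sub>a ?k) \<otimes>\<^sub>a Id C W"
    using V W M \<sigma> by (simp add: TensorA_assoc Hom_iff)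
  ultimately have "(\<rho> \<otimes>\<^sub>a Id C W) \<cdot> (\<rho> \<otimes>\<^sub>a Id C (V \<otimes>\<^sub>o W)) \<cdot>
      (Id C M \<otimes>\<^sub>a Plus C (Id C (V \<otimes>\<^sub>o V \<otimes>\<^sub>o W)) (neg C \<sigma> \<otimes>\<^sub>a Id C W)) =
      (\<rho> \<cdot> (\<rho> \<otimes>\<^sub>a Id C V) \<cdot> (Id C M \<otimes>\<^sub>a ?k)) \<otimes>\<^sub>a Id C W"
    using V W M \<sigma> \<rho> by (simp add: interchange Hom_iff)
  also have "\<dots> = Zero C (M \<otimes>\<^sub>o V \<otimes>\<^sub>o V) M \<otimes>\<^sub>a Id C W"
    unfolding right_action_one_minus_braiding[OF bim V \<sigma>] ..
  also have "\<dots> = Zero C (M \<otimes>\<^sub>o V \<otimes>\<^sub>o V \<otimes>\<^sub>o W) (M \<otimes>\<^sub>o W)"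
    using TensorA_Zero(2)[OF Id_Hom[OF W], of "M \<otimes>\<^sub>o V \<otimes>\<^sub>o V" M] V W M by simp
  finally show ?thesis .
qed

text \<open>Between the two actions \<open>M\<close> travels back and forth across the same strands, so these
  braidings cancel and the left module axiom applies.\<close>

lemma last_action_twice:
  assumes bim: "bimodule C V \<sigma> M \<rho> \<mu>" and V: "V \<in> Obj C" and \<sigma>: "\<sigma> \<in> Hom C (V \<otimes>\<^sub>o V) (V \<otimes>\<^sub>o V)"
    and W: "W \<in> Obj C"
  shows "last_action C V M \<mu> W \<cdot> last_action C V M \<mu> (W \<otimes>\<^sub>o V) \<cdot>
      (Id C M \<otimes>\<^sub>a Plus C (Id C (W \<otimes>\<^sub>o V \<otimes>\<^sub>o V)) (Id C W \<otimes>\<^sub>a neg C \<sigma>)) =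
    Zero C (M \<otimes>\<^sub>o W \<otimes>\<^sub>o V \<otimes>\<^sub>o V) (M \<otimes>\<^sub>o W)"
proof -
  have M: "M \<in> Obj C" and \<mu>: "\<mu> \<in> Hom C (V \<otimes>\<^sub>o M) M" using bim by (auto simp: bimodule_def)
  have mu: "\<mu> \<in> Arr C" "Dom C \<mu> = V \<otimes>\<^sub>o M" "Cod C \<mu> = M" using \<mu> by (auto simp: Hom_iff)
  let ?k = "Plus C (Id C (V \<otimes>\<^sub>o V)) (neg C \<sigma>)"
  have k: "?k \<in> Hom C (V \<otimes>\<^sub>o V) (V \<otimes>\<^sub>o V)" using V \<sigma> by (simp add: Hom_iff)
  then have kA: "?k \<in> Arr C" "Dom C ?k = V \<otimes>\<^sub>o V" "Cod C ?k = V \<otimes>\<^sub>o V" by (auto simp: Hom_iff)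
  have VV: "V \<otimes>\<^sub>o V \<in> Obj C" using V by simp
  have "Plus C (Id C (W \<otimes>\<^sub>o V \<otimes>\<^sub>o V)) (Id C W \<otimes>\<^sub>a neg C \<sigma>) = Id C W \<otimes>\<^sub>a ?k"
    using TensorA_Plus_right[OF Id_Hom[OF W] Id_Hom[OF VV] neg_Hom(1)[OF \<sigma>]] TensorA_Id[OF W VV]
    by simp
  moreover have "last_action C V M \<mu> W \<cdot> last_action C V M \<mu> (W \<otimes>\<^sub>o V) \<cdot> (Id C M \<otimes>\<^sub>a (Id C W \<otimes>\<^sub>a ?k)) =
      Braid C W M \<cdot> (Id C W \<otimes>\<^sub>a (\<mu> \<cdot> (Id C V \<otimes>\<^sub>a \<mu>) \<cdot> (?k \<otimes>\<^sub>a Id C M))) \<cdot> Braid C M (W \<otimes>\<^sub>o V \<otimes>\<^sub>o V)"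
  proof -
    have "last_action C V M \<mu> W \<cdot> last_action C V M \<mu> (W \<otimes>\<^sub>o V) \<cdot> (Id C M \<otimes>\<^sub>a (Id C W \<otimes>\<^sub>a ?k)) =
      Braid C W M \<cdot> (Id C W \<otimes>\<^sub>a \<mu>) \<cdot> (Braid C M (W \<otimes>\<^sub>o V) \<cdot> Braid C (W \<otimes>\<^sub>o V) M) \<cdot>
      (Id C (W \<otimes>\<^sub>o V) \<otimes>\<^sub>a \<mu>) \<cdot> (Braid C M (W \<otimes>\<^sub>o V \<otimes>\<^sub>o V) \<cdot> (Id C M \<otimes>\<^sub>a (Id C W \<otimes>\<^sub>a ?k)))"
      unfolding last_action_def using V M W mu kA by (simp add: comp_assoc)
    also have "Braid C M (W \<otimes>\<^sub>o V) \<cdot> Braid C (W \<otimes>\<^sub>o V) M = Id C (W \<otimes>\<^sub>o V \<otimes>\<^sub>o M)"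
      using Braid_symmetric[of "W \<otimes>\<^sub>o V" M] V M W by simp
    also have "Braid C M (W \<otimes>\<^sub>o V \<otimes>\<^sub>o V) \<cdot> (Id C M \<otimes>\<^sub>a (Id C W \<otimes>\<^sub>a ?k)) =
        ((Id C W \<otimes>\<^sub>a ?k) \<otimes>\<^sub>a Id C M) \<cdot> Braid C M (W \<otimes>\<^sub>o V \<otimes>\<^sub>o V)"
      by (rule Braid_natural[OF Id_Hom[OF M] TensorA_Hom[OF Id_Hom[OF W] k]])
    also have "Id C (W \<otimes>\<^sub>o V) \<otimes>\<^sub>a \<mu> = Id C W \<otimes>\<^sub>a Id C V \<otimes>\<^sub>a \<mu>"
      using V W mu by (simp add: TensorA_Id[symmetric] TensorA_assoc)
    finally show ?thesis
      using V M W mu kA by (simp add: comp_assoc[symmetric] interchange TensorA_assoc)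
  qed
  ultimately have "last_action C V M \<mu> W \<cdot> last_action C V M \<mu> (W \<otimes>\<^sub>o V) \<cdot>
      (Id C M \<otimes>\<^sub>a Plus C (Id C (W \<otimes>\<^sub>o V \<otimes>\<^sub>o V)) (Id C W \<otimes>\<^sub>a neg C \<sigma>)) =
      Braid C W M \<cdot> (Id C W \<otimes>\<^sub>a Zero C (V \<otimes>\<^sub>o V \<otimes>\<^sub>o M) M) \<cdot> Braid C M (W \<otimes>\<^sub>o V \<otimes>\<^sub>o V)"
    using left_action_one_minus_braiding[OF bim V \<sigma>] by simp
  also have "\<dots> = Zero C (M \<otimes>\<^sub>o W \<otimes>\<^sub>o V \<otimes>\<^sub>o V) (M \<otimes>\<^sub>o W)"
  proof -
    have o: "M \<otimes>\<^sub>o W \<otimes>\<^sub>o V \<otimes>\<^sub>o V \<in> Obj C" "W \<otimes>\<^sub>o M \<in> Obj C" "W \<otimes>\<^sub>o V \<otimes>\<^sub>o V \<in> Obj C" "V \<otimes>\<^sub>o V \<otimes>\<^sub>o M \<in> Obj C"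
      using V M W by auto
    have B: "Braid C M (W \<otimes>\<^sub>o V \<otimes>\<^sub>o V) \<in> Hom C (M \<otimes>\<^sub>o W \<otimes>\<^sub>o V \<otimes>\<^sub>o V) (W \<otimes>\<^sub>o V \<otimes>\<^sub>o V \<otimes>\<^sub>o M)"
      using V M W by (simp add: Hom_iff)
    show ?thesis
      unfolding TensorA_Zero(1)[OF Id_Hom[OF W] o(4) M] Zero_Comp[OF B o(2)]
        Comp_Zero[OF Braid_Hom[OF W M] o(1)] ..
  qed
  finally show ?thesis .
qed

end

section \<open>The bidifferential\<close>

text \<open>By naturality the passage of \<open>M\<close> across all strands can be postponed until after the
  co-shuffle.\<close>

lemma d_lambda_eq:
  fixes C (structure)
  assumes "symmetric_preadditive_strict_monoidal_category C"
    and pb: "pre_braided_object C V \<sigma>" and bim: "bimodule C V \<sigma> M \<rho> \<mu>"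
  shows "d_lambda C V \<sigma> M \<mu> (Suc m) =
    scale C ((-1) ^ m) (last_action C V M \<mu> (tpow C V m) \<cdot> (Id C M \<otimes>\<^sub>a csh C V (neg C \<sigma>) m 1))"
proof -
  interpret symmetric_preadditive_strict_monoidal_category C by fact
  have V: "V \<in> Obj C" and b: "neg C \<sigma> \<in> Hom C (V \<otimes>\<^sub>o V) (V \<otimes>\<^sub>o V)"
    using pre_braided_neg[OF pb] by (auto simp: pre_braided_object_def)
  have M: "M \<in> Obj C" and \<mu>: "\<mu> \<in> Hom C (V \<otimes>\<^sub>o M) M" using bim by (auto simp: bimodule_def)
  let ?W = "tpow C V m"
  note R = csh_Hom(2)[OF V b, of m]
  have "?W \<otimes>\<^sub>o (V \<otimes>\<^sub>o M) = V \<otimes>\<^sub>o (?W \<otimes>\<^sub>o M)"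
    using tpow_snoc[OF V, of m] TensorO_assoc V M by (metis tpow_Obj)
  moreover
  have "(csh C V (neg C \<sigma>) m 1 \<otimes>\<^sub>a Id C M) \<cdot> Braid C M (tpow C V (Suc m)) =
      Braid C M (tpow C V (Suc m)) \<cdot> (Id C M \<otimes>\<^sub>a csh C V (neg C \<sigma>) m 1)"
    using Braid_natural[OF Id_Hom[OF M] R] by simp
  ultimately have "inverse_arr C (Braid C M ?W) \<cdot> (Id C ?W \<otimes>\<^sub>a \<mu>) \<cdot>
      (csh C V (neg C \<sigma>) m 1 \<otimes>\<^sub>a Id C M) \<cdot> Braid C M (tpow C V (Suc m)) =
      last_action C V M \<mu> ?W \<cdot> (Id C M \<otimes>\<^sub>a csh C V (neg C \<sigma>) m 1)"
    using V M \<mu> R tpow_snoc[OF V, of m] inverse_arr_Braid[OF M, of ?W]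
    by (simp add: last_action_def comp_assoc Hom_iff)
  then show ?thesis unfolding d_lambda_def by simp
qed

theorem proposition6p10:
  fixes C :: "('o, 'a, 'x) moncat_scheme" and V M :: 'o and \<sigma> \<rho> \<mu> :: 'a
  assumes "symmetric_preadditive_strict_monoidal_category C"
    and "pre_braided_object C V \<sigma>"
    and "bimodule C V \<sigma> M \<rho> \<mu>"
  shows "tensor_bidifferential C V M (rho_d C V \<sigma> M \<rho>) (d_lambda C V \<sigma> M \<mu>)"
proof -
  interpret symmetric_preadditive_strict_monoidal_category C by fact
  note pb = assms(2) and bim = assms(3)
  define \<beta> where "\<beta> = neg C \<sigma>"
  have pb': "pre_braided_object C V \<beta>" unfolding \<beta>_def by (rule pre_braided_neg[OF pb])
  have V: "V \<in> Obj C" and \<sigma>: "\<sigma> \<in> Hom C (V \<otimes>\<^sub>o\<^bsub>C\<^esub> V) (V \<otimes>\<^sub>o\<^bsub>C\<^esub> V)"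
    using pb by (auto simp: pre_braided_object_def)
  have \<beta>: "\<beta> \<in> Hom C (V \<otimes>\<^sub>o\<^bsub>C\<^esub> V) (V \<otimes>\<^sub>o\<^bsub>C\<^esub> V)"
    using pb' by (auto simp: pre_braided_object_def)
  have M: "M \<in> Obj C" and \<rho>: "\<rho> \<in> Hom C (M \<otimes>\<^sub>o\<^bsub>C\<^esub> V) M" and \<mu>: "\<mu> \<in> Hom C (V \<otimes>\<^sub>o\<^bsub>C\<^esub> M) M"
    using bim by (auto simp: bimodule_def)
  let ?X = "\<lambda>n. tpow C V n" and ?MX = "\<lambda>n. M \<otimes>\<^sub>o\<^bsub>C\<^esub> tpow C V n"
  have MX: "?MX n \<in> Obj C" for n using V M by simp
  define l where "l n = csh C V \<beta> 1 n" for n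
  define r where "r n = csh C V \<beta> n 1" for n
  have l: "l n \<in> Hom C (?X (Suc n)) (?X (Suc n))" and r: "r n \<in> Hom C (?X (Suc n)) (?X (Suc n))" for n
    unfolding l_def r_def using csh_Hom[OF V \<beta>] by auto
  define p where "p n = \<rho> \<otimes>\<^sub>a\<^bsub>C\<^esub> Id C (?X n)" for n
  define q where "q n = last_action C V M \<mu> (?X n)" for n
  define I where "I f = Id C M \<otimes>\<^sub>a\<^bsub>C\<^esub> f" for f
  have p: "p n \<in> Hom C (?MX (Suc n)) (?MX n)" for n
    unfolding p_def using V M \<rho> by (simp add: Hom_iff)
  have q: "q n \<in> Hom C (?MX (Suc n)) (?MX n)" for n
    unfolding q_def using last_action_Hom[OF V M tpow_Obj[OF V] \<mu>, of n] V
    by (simp add: tpow_snoc)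
  have I: "I f \<in> Hom C (?MX n) (?MX n)" if "f \<in> Hom C (?X n) (?X n)" for f n
    unfolding I_def using TensorA_Hom[OF Id_Hom[OF M] that] .
  have I_comp: "I (f \<cdot>\<^bsub>C\<^esub> g) = I f \<cdot>\<^bsub>C\<^esub> I g"
    if "f \<in> Hom C (?X n) (?X n)" "g \<in> Hom C (?X n) (?X n)" for f g n
    unfolding I_def using TensorA_Comp[OF Id_Hom[OF M] Id_Hom[OF M] that(2,1)] M by simp
  have p_slide: "I f \<cdot>\<^bsub>C\<^esub> p n = p n \<cdot>\<^bsub>C\<^esub> I (Id C V \<otimes>\<^sub>a\<^bsub>C\<^esub> f)" if f: "f \<in> Hom C (?X n) (?X n)" for f n
    unfolding I_def p_def using slide[OF \<rho> f] V M f
    by (simp add: TensorA_Id[symmetric] TensorA_assoc Hom_iff)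
  have q_slide: "I f \<cdot>\<^bsub>C\<^esub> q n = q n \<cdot>\<^bsub>C\<^esub> I (f \<otimes>\<^sub>a\<^bsub>C\<^esub> Id C V)" if f: "f \<in> Hom C (?X n) (?X n)" for f n
    unfolding I_def q_def using last_action_slide[OF V M tpow_Obj[OF V] \<mu> f] .
  have whisk: "Id C V \<otimes>\<^sub>a\<^bsub>C\<^esub> f \<in> Hom C (?X (Suc n)) (?X (Suc n))"
    "f \<otimes>\<^sub>a\<^bsub>C\<^esub> Id C V \<in> Hom C (?X (Suc n)) (?X (Suc n))" if f: "f \<in> Hom C (?X n) (?X n)" for f n
    using TensorA_Hom[OF Id_Hom[OF V] f] TensorA_Hom[OF f Id_Hom[OF V]] tpow_snoc[OF V] by simp_all
  \<comment> \<open>The two families, shifted by one and the second one without its sign.\<close>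
  define d where "d n = p n \<cdot>\<^bsub>C\<^esub> I (l n)" for n
  define e where "e n = q n \<cdot>\<^bsub>C\<^esub> I (r n)" for n
  have d: "d n \<in> Hom C (?MX (Suc n)) (?MX n)" for n
    unfolding d_def using Comp_Hom[OF I[OF l] p] .
  have e: "e n \<in> Hom C (?MX (Suc n)) (?MX n)" for n
    unfolding e_def using Comp_Hom[OF I[OF r] q] .
  have rho_d: "rho_d C V \<sigma> M \<rho> (Suc n) = d n" for n
    by (simp add: rho_d_def d_def p_def I_def l_def \<beta>_def)
  have d_lambda: "d_lambda C V \<sigma> M \<mu> (Suc n) = (if even n then e n else neg C (e n))" for n
    using d_lambda_eq[OF assms] scale_sign[OF e[of n]]
    by (simp add: e_def q_def I_def r_def \<beta>_def)
  \<comment> \<open>Two consecutive differentials consist of two actions after two co-shuffles, as a co-shuffle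
    slides past an action at the price of one more strand.\<close>
  have merge: "(a m \<cdot>\<^bsub>C\<^esub> I f) \<cdot>\<^bsub>C\<^esub> (b (Suc m) \<cdot>\<^bsub>C\<^esub> I g) = a m \<cdot>\<^bsub>C\<^esub> b (Suc m) \<cdot>\<^bsub>C\<^esub> I (h \<cdot>\<^bsub>C\<^esub> g)"
    if "\<And>n. a n \<in> Hom C (?MX (Suc n)) (?MX n)" "\<And>n. b n \<in> Hom C (?MX (Suc n)) (?MX n)"
      "f \<in> Hom C (?X (Suc m)) (?X (Suc m))" "g \<in> Hom C (?X (Suc (Suc m))) (?X (Suc (Suc m)))"
      "h \<in> Hom C (?X (Suc (Suc m))) (?X (Suc (Suc m)))" "I f \<cdot>\<^bsub>C\<^esub> b (Suc m) = b (Suc m) \<cdot>\<^bsub>C\<^esub> I h"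
    for a b f g h m
  proof -
    have "(a m \<cdot>\<^bsub>C\<^esub> I f) \<cdot>\<^bsub>C\<^esub> (b (Suc m) \<cdot>\<^bsub>C\<^esub> I g) = a m \<cdot>\<^bsub>C\<^esub> (I f \<cdot>\<^bsub>C\<^esub> b (Suc m)) \<cdot>\<^bsub>C\<^esub> I g"
      using that(1)[of m] that(2)[of "Suc m"] I[OF that(3)] I[OF that(4)] by (simp add: Hom_iff comp_assoc)
    also have "\<dots> = a m \<cdot>\<^bsub>C\<^esub> b (Suc m) \<cdot>\<^bsub>C\<^esub> I (h \<cdot>\<^bsub>C\<^esub> g)"
      unfolding that(6) I_comp[OF that(5,4)]
      using that(1)[of m] that(2)[of "Suc m"] I[OF that(4)] I[OF that(5)] by (simp add: Hom_iff comp_assoc)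
    finally show ?thesis .
  qed
  have dd: "d m \<cdot>\<^bsub>C\<^esub> d (Suc m) = Zero C (?MX (Suc (Suc m))) (?MX m)" for m
  proof -
    let ?k = "Plus C (Id C (?X (Suc (Suc m)))) (\<beta> \<otimes>\<^sub>a\<^bsub>C\<^esub> Id C (?X m))"
    obtain y where y: "y \<in> Hom C (?X (Suc (Suc m))) (?X (Suc (Suc m)))"
      "(Id C V \<otimes>\<^sub>a\<^bsub>C\<^esub> l m) \<cdot>\<^bsub>C\<^esub> l (Suc m) = ?k \<cdot>\<^bsub>C\<^esub> y"
      using csh_first_strand_factor[OF pb', of m] unfolding l_def by auto
    have k: "?k \<in> Hom C (?X (Suc (Suc m))) (?X (Suc (Suc m)))"
      using V \<beta> by (simp add: Hom_iff)
    have kill: "p m \<cdot>\<^bsub>C\<^esub> p (Suc m) \<cdot>\<^bsub>C\<^esub> I ?k = Zero C (?MX (Suc (Suc m))) (?MX m)"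
      using first_action_twice[OF bim V \<sigma> tpow_Obj[OF V], of m] by (simp add: p_def I_def \<beta>_def)
    have "d m \<cdot>\<^bsub>C\<^esub> d (Suc m) = p m \<cdot>\<^bsub>C\<^esub> p (Suc m) \<cdot>\<^bsub>C\<^esub> I (?k \<cdot>\<^bsub>C\<^esub> y)"
      unfolding d_def y(2)[symmetric]
      by (rule merge[OF p p l l whisk(1)[OF l] p_slide[OF l]])
    also have "\<dots> = (p m \<cdot>\<^bsub>C\<^esub> p (Suc m) \<cdot>\<^bsub>C\<^esub> I ?k) \<cdot>\<^bsub>C\<^esub> I y"
      unfolding I_comp[OF k y(1)] using p[of m] p[of "Suc m"] I[OF k] I[OF y(1)]
      by (simp add: Hom_iff comp_assoc)
    also have "\<dots> = Zero C (?MX (Suc (Suc m))) (?MX m)"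
      unfolding kill by (rule Zero_Comp[OF I[OF y(1)] MX])
    finally show ?thesis .
  qed
  have ee: "e m \<cdot>\<^bsub>C\<^esub> e (Suc m) = Zero C (?MX (Suc (Suc m))) (?MX m)" for m
  proof -
    let ?k = "Plus C (Id C (?X (Suc (Suc m)))) (Id C (?X m) \<otimes>\<^sub>a\<^bsub>C\<^esub> \<beta>)"
    obtain y where y: "y \<in> Hom C (?X (Suc (Suc m))) (?X (Suc (Suc m)))"
      "(r m \<otimes>\<^sub>a\<^bsub>C\<^esub> Id C V) \<cdot>\<^bsub>C\<^esub> r (Suc m) = ?k \<cdot>\<^bsub>C\<^esub> y"
      using csh_last_strand_factor[OF pb', of m] unfolding r_def by auto
    have XVV: "?X m \<otimes>\<^sub>o\<^bsub>C\<^esub> V \<otimes>\<^sub>o\<^bsub>C\<^esub> V = ?X (Suc (Suc m))"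
      using tpow_add[OF V, of m "Suc (Suc 0)"] V by simp
    have XV: "?X m \<otimes>\<^sub>o\<^bsub>C\<^esub> V = ?X (Suc m)" using tpow_snoc[OF V, of m] by simp
    have k: "?k \<in> Hom C (?X (Suc (Suc m))) (?X (Suc (Suc m)))"
      using Plus_Hom[OF Id_Hom TensorA_Hom[OF Id_Hom \<beta>, of "?X m", unfolded XVV]] V
      by (simp del: tpow.simps)
    have kill: "q m \<cdot>\<^bsub>C\<^esub> q (Suc m) \<cdot>\<^bsub>C\<^esub> I ?k = Zero C (?MX (Suc (Suc m))) (?MX m)"
      using last_action_twice[OF bim V \<sigma> tpow_Obj[OF V], of m] unfolding XVV XV q_def I_def \<beta>_def .
    have "e m \<cdot>\<^bsub>C\<^esub> e (Suc m) = q m \<cdot>\<^bsub>C\<^esub> q (Suc m) \<cdot>\<^bsub>C\<^esub> I (?k \<cdot>\<^bsub>C\<^esub> y)"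
      unfolding e_def y(2)[symmetric]
      by (rule merge[OF q q r r whisk(2)[OF r] q_slide[OF r]])
    also have "\<dots> = (q m \<cdot>\<^bsub>C\<^esub> q (Suc m) \<cdot>\<^bsub>C\<^esub> I ?k) \<cdot>\<^bsub>C\<^esub> I y"
      unfolding I_comp[OF k y(1)] using q[of m] q[of "Suc m"] I[OF k] I[OF y(1)]
      by (simp add: Hom_iff comp_assoc)
    also have "\<dots> = Zero C (?MX (Suc (Suc m))) (?MX m)"
      unfolding kill by (rule Zero_Comp[OF I[OF y(1)] MX])
    finally show ?thesis .
  qed
  have de: "d m \<cdot>\<^bsub>C\<^esub> e (Suc m) = e m \<cdot>\<^bsub>C\<^esub> d (Suc m)" for m
  proof -
    have pq: "p m \<cdot>\<^bsub>C\<^esub> q (Suc m) = q m \<cdot>\<^bsub>C\<^esub> p (Suc m)"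
      using first_last_action_commute[OF bim V tpow_Obj[OF V], of m] tpow_snoc[OF V, of m]
      by (simp add: p_def q_def)
    let ?z = "(l m \<otimes>\<^sub>a\<^bsub>C\<^esub> Id C V) \<cdot>\<^bsub>C\<^esub> r (Suc m)"
    have z: "I ?z \<in> Hom C (?MX (Suc (Suc m))) (?MX (Suc (Suc m)))"
      by (rule I[OF Comp_Hom[OF r whisk(2)[OF l]]])
    have "d m \<cdot>\<^bsub>C\<^esub> e (Suc m) = p m \<cdot>\<^bsub>C\<^esub> q (Suc m) \<cdot>\<^bsub>C\<^esub> I ?z"
      unfolding d_def e_def by (rule merge[OF p q l r whisk(2)[OF l] q_slide[OF l]])
    also have "\<dots> = (q m \<cdot>\<^bsub>C\<^esub> p (Suc m)) \<cdot>\<^bsub>C\<^esub> I ?z"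
      unfolding pq[symmetric] using p[of m] q[of "Suc m"] z by (simp add: Hom_iff comp_assoc)
    also have "\<dots> = q m \<cdot>\<^bsub>C\<^esub> p (Suc m) \<cdot>\<^bsub>C\<^esub> I ?z"
      using q[of m] p[of "Suc m"] z by (simp add: Hom_iff comp_assoc)
    also have "?z = (Id C V \<otimes>\<^sub>a\<^bsub>C\<^esub> r m) \<cdot>\<^bsub>C\<^esub> l (Suc m)"
      unfolding l_def r_def by (rule csh_coassoc[OF pb'])
    also have "q m \<cdot>\<^bsub>C\<^esub> p (Suc m) \<cdot>\<^bsub>C\<^esub> I \<dots> = e m \<cdot>\<^bsub>C\<^esub> d (Suc m)"
      unfolding d_def e_def by (rule merge[OF q p r l whisk(1)[OF r] p_slide[OF r], symmetric])
    finally show ?thesis .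
  qed
  have neg_zero: "neg C (Zero C (?MX (Suc (Suc m))) (?MX m)) = Zero C (?MX (Suc (Suc m))) (?MX m)" for m
    using negI[OF Zero_Hom Zero_Hom Plus_Zero(1)[OF Zero_Hom]] MX by metis
  show ?thesis
    unfolding tensor_bidifferential_def
  proof (intro conjI allI impI)
    fix n :: nat assume "1 \<le> n"
    then obtain m where m: "n = Suc m" by (cases n) auto
    show "rho_d C V \<sigma> M \<rho> n \<in> Hom C (?MX n) (?MX (n - 1))"
      unfolding m rho_d using d[of m] by simp
    show "d_lambda C V \<sigma> M \<mu> n \<in> Hom C (?MX n) (?MX (n - 1))"
      unfolding m d_lambda using e[of m] neg_Hom(1)[OF e[of m]] by simp
  next
    fix n :: nat assume "1 < n"
    define m where "m = n - 2"
    with \<open>1 < n\<close> have m: "n = Suc (Suc m)" by linarith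
    have n: "n - 1 = Suc m" "n - 2 = m" using m by auto
    show "rho_d C V \<sigma> M \<rho> (n - 1) \<cdot>\<^bsub>C\<^esub> rho_d C V \<sigma> M \<rho> n = Zero C (?MX n) (?MX (n - 2))"
      unfolding n unfolding m rho_d by (rule dd)
    show "d_lambda C V \<sigma> M \<mu> (n - 1) \<cdot>\<^bsub>C\<^esub> d_lambda C V \<sigma> M \<mu> n = Zero C (?MX n) (?MX (n - 2))"
      unfolding n unfolding m d_lambda
      using Comp_neg[OF e[of "Suc m"] e[of m]] ee[of m] neg_zero[of m] by simp
    have z: "d m \<cdot>\<^bsub>C\<^esub> e (Suc m) \<in> Hom C (?MX (Suc (Suc m))) (?MX m)"
      by (rule Comp_Hom[OF e d])
    have comm: "Plus C (neg C (d m \<cdot>\<^bsub>C\<^esub> e (Suc m))) (d m \<cdot>\<^bsub>C\<^esub> e (Suc m)) =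
        Zero C (?MX (Suc (Suc m))) (?MX m)"
      using neg_Hom(2)[OF neg_Hom(1)[OF z]] unfolding neg_neg[OF z] .
    show "Plus C (rho_d C V \<sigma> M \<rho> (n - 1) \<cdot>\<^bsub>C\<^esub> d_lambda C V \<sigma> M \<mu> n)
        (d_lambda C V \<sigma> M \<mu> (n - 1) \<cdot>\<^bsub>C\<^esub> rho_d C V \<sigma> M \<rho> n) = Zero C (?MX n) (?MX (n - 2))"
      unfolding n unfolding m rho_d d_lambda
      using Comp_neg(1)[OF e[of "Suc m"] d[of m]] Comp_neg(2)[OF d[of "Suc m"] e[of m]]
        de[of m] neg_Hom(2)[OF z] comm by simp
  qed
qed

end
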